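(* Let $G$ be a connected finite simple graph. Then $G$ is geodetic and contains no induced subgraph isomorphic to $K_{1,3}$ if and only if either $G$ is a cycle of odd length, or every block of $G$ is a complete graph and every vertex of $G$ belongs to at most two blocks of $G$.
   Context: A geodesic between two vertices is a shortest path connecting them. A graph is geodetic if for every pair of its vertices there is exactly one geodesic between them. A cut vertex of $G$ is a vertex $x$ such that $G-x$ is disconnected; a block of $G$ is a maximal connected subgraph of $G$ without a cut vertex. $K_{1,3}$ is the star with three leaves. *)

theory Defs
  imports "Graph_Theory.Graph_Theory"
begin

text \<open>
  Finite simple graphs are modelled by the locale \<^locale>\<open>graph\<close>, that is, as finite, symmetric,
  loop-free digraphs without parallel arcs. The notion \<^const>\<open>connected\<close> excludes the null graph.
\<close>

definition geodesic :: "('a,'b) pre_digraph \<Rightarrow> 'a \<Rightarrow> 'a \<Rightarrow> 'a vwalk \<Rightarrow> bool" where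
  "geodesic G u v p \<longleftrightarrow>
     vpath p G \<and> hd p = u \<and> last p = v \<and>
     (\<forall>q. vpath q G \<and> hd q = u \<and> last q = v \<longrightarrow> vwalk_length p \<le> vwalk_length q)"

definition geodetic :: "('a,'b) pre_digraph \<Rightarrow> bool" where
  "geodetic G \<longleftrightarrow> (\<forall>u\<in>verts G. \<forall>v\<in>verts G. \<exists>!p. geodesic G u v p)"

text \<open>
  The null graph is neither connected in the sense of \<^const>\<open>connected\<close> nor disconnected;
  the nonemptiness condition ensures that the vertex of a one-vertex graph is not a cut vertex.
\<close>

definition cut_vertex :: "('a,'b) pre_digraph \<Rightarrow> 'a \<Rightarrow> bool" where
  "cut_vertex G x \<longleftrightarrow>
     x \<in> verts G \<and> verts (pre_digraph.del_vert G x) \<noteq> {} \<and>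
     \<not> connected (pre_digraph.del_vert G x)"

text \<open>
  A \<^const>\<open>subgraph\<close> in the library sense need not be symmetric, hence \<^term>\<open>graph H\<close> below.
\<close>

definition block :: "('a,'b) pre_digraph \<Rightarrow> ('a,'b) pre_digraph \<Rightarrow> bool" where
  "block G B \<longleftrightarrow>
     pre_digraph.max_subgraph G (\<lambda>H. graph H \<and> connected H \<and> (\<nexists>x. cut_vertex H x)) B"

definition cycle_graph :: "nat \<Rightarrow> ('a,'b) pre_digraph \<Rightarrow> bool" where
  "cycle_graph n G \<longleftrightarrow>
     graph G \<and> n \<ge> 3 \<and>
     (\<exists>f. bij_betw f {0..<n} (verts G) \<and>
          arcs_ends G = (\<Union>i\<in>{0..<n}. {(f i, f (Suc i mod n)), (f (Suc i mod n), f i)}))"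

text \<open>Consequently \<^const>\<open>card\<close> really counts the blocks of a finite graph.\<close>

lemma (in fin_digraph) finite_blocks: "finite {B. block G B}"
proof (rule finite_subset)
  show "{B. block G B} \<subseteq>
    (\<lambda>(V, A). \<lparr>verts = V, arcs = A, tail = tail G, head = head G\<rparr>) ` (Pow (verts G) \<times> Pow (arcs G))"
  proof
    fix B assume "B \<in> {B. block G B}"
    then have "subgraph B G" by (simp add: block_def max_subgraph_def)
    then have "verts B \<subseteq> verts G" "arcs B \<subseteq> arcs G"
      "B = \<lparr>verts = verts B, arcs = arcs B, tail = tail G, head = head G\<rparr>"
      by (auto simp: subgraph_def compatible_def)
    then show "B \<in> (\<lambda>(V, A). \<lparr>verts = V, arcs = A, tail = tail G, head = head G\<rparr>) `
        (Pow (verts G) \<times> Pow (arcs G))"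
      by (intro image_eqI[of _ _ "(verts B, arcs B)"]) auto
  qed
qed simp

end

theory Submission
  imports Defs
begin

text \<open>
  Every block is complete iff every cycle spans a clique, that is, iff two neighbours \<open>u\<close>, \<open>w\<close> of \<open>v\<close>
  joined by a walk avoiding \<open>v\<close> are equal or adjacent. In a geodetic graph without induced
  \<open>K\<^bsub>1,3\<^esub>\<close> where this fails, a shortest such walk from \<open>u\<close> to \<open>w\<close> closes up with \<open>v\<close> to a shortest
  induced cycle \<open>c\<close> of length \<open>k \<ge> 4\<close>. It is isometric, and \<open>k = 2m + 1\<close> is odd because antipodal
  vertices of an even isometric cycle are joined by two geodesics. A vertex \<open>x\<close> attached to the
  cycle is, by claw-freeness, adjacent to two consecutive vertices \<open>c 0\<close>, \<open>c 1\<close>, and uniqueness of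
  geodesics puts it at distance \<open>m\<close> from the opposite vertex \<open>c (m + 1)\<close>. The geodesic between
  them closes a cycle of length \<open>2m\<close> with one of the two arcs, so minimality of \<open>k\<close> makes its first
  inner vertex adjacent to \<open>c 1\<close> (or \<open>c 0\<close>), which again contradicts uniqueness of geodesics.
  Hence the cycle is the whole graph.
\<close>

section \<open>Walks as relation powers\<close>

lemma sym_relpow:
  assumes "sym R" "(a, b) \<in> R ^^ n"
  shows "(b, a) \<in> R ^^ n"
  using assms(2)
proof (induction n arbitrary: b)
  case (Suc n)
  then obtain c where "(a, c) \<in> R ^^ n" "(c, b) \<in> R" by auto
  then have "(b, c) \<in> R" "(c, a) \<in> R ^^ n"
    using Suc.IH assms(1) by (auto dest: symD)
  then show ?case by (rule relpow_Suc_I2)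
qed simp

lemma relpow_trans: "(a, b) \<in> R ^^ m \<Longrightarrow> (b, c) \<in> R ^^ n \<Longrightarrow> (a, c) \<in> R ^^ (m + n)"
  by (auto simp: relpow_add)

lemma relpow_int_seq:
  fixes c :: "int \<Rightarrow> 'a"
  assumes "\<And>t. t < s \<Longrightarrow> (c (i + int t), c (i + int t + 1)) \<in> R"
  shows "(c i, c (i + int s)) \<in> R ^^ s"
  using assms
proof (induction s)
  case (Suc s)
  have "(c i, c (i + int s)) \<in> R ^^ s" "(c (i + int s), c (i + int s + 1)) \<in> R"
    using Suc.IH Suc.prems by auto
  then show ?case by (auto simp: algebra_simps)
qed simp

lemma relpow_nat_seq:
  assumes "\<And>t. i \<le> t \<Longrightarrow> t < j \<Longrightarrow> (f t, f (Suc t)) \<in> R" "i \<le> j"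
  shows "(f i, f j) \<in> R ^^ (j - i)"
  unfolding relpow_fun_conv
  by (rule exI[of _ "\<lambda>t. f (i + t)"]) (use assms in auto)

lemma periodic_mod:
  fixes c :: "int \<Rightarrow> 'a"
  assumes "\<And>i. c (i + p) = c i"
  shows "c (i mod p) = c i"
proof -
  have "c (j + n * p) = c j" for j n
  proof (induction n rule: int_induct[of _ 0])
    case (step1 n)
    have "j + (n + 1) * p = (j + n * p) + p" by (simp add: algebra_simps)
    then show ?case using step1 assms[of "j + n * p"] by (simp add: add.assoc)
  next
    case (step2 n)
    have "c (j + (n - 1) * p) = c (j + (n - 1) * p + p)" using assms by simp
    also have "j + (n - 1) * p + p = j + n * p" by (simp add: algebra_simps)
    finally show ?case using step2 by simp
  qed simp
  from this[of "i mod p" "i div p"] show ?thesis by (simp add: add.commute)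
qed

section \<open>Distances in a connected graph\<close>

text \<open>Walks of length \<open>n\<close> become elements of \<open>E ^^ n\<close>;
  \<open>connected_graph\<close> later instantiates \<open>V\<close> and \<open>E\<close> with
  \<open>verts G\<close> and \<open>arcs_ends G\<close>.\<close>

locale connected_rel =
  fixes V :: "'a set" and E :: "'a rel"
  assumes E_sub: "E \<subseteq> V \<times> V"
    and sym_E: "sym E"
    and irrefl_E: "(x, x) \<notin> E"
    and conn: "u \<in> V \<Longrightarrow> v \<in> V \<Longrightarrow> (u, v) \<in> E\<^sup>*"
begin

definition d :: "'a \<Rightarrow> 'a \<Rightarrow> nat" where
  "d u v = (LEAST n. (u, v) \<in> E ^^ n)"

abbreviation avoiding :: "'a \<Rightarrow> 'a rel" where
  "avoiding x \<equiv> Restr E (- {x})"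

lemma E_sym: "(u, v) \<in> E \<Longrightarrow> (v, u) \<in> E"
  using sym_E by (rule symD)

lemma E_V: "(u, v) \<in> E \<Longrightarrow> u \<in> V" "(u, v) \<in> E \<Longrightarrow> v \<in> V"
  using E_sub by auto

lemma sym_avoiding: "sym (avoiding x)"
  by (auto intro!: symI E_sym)

lemma d_le: "(u, v) \<in> E ^^ n \<Longrightarrow> d u v \<le> n"
  unfolding d_def by (rule Least_le)

lemma d_walk:
  assumes "u \<in> V" "v \<in> V"
  shows "(u, v) \<in> E ^^ d u v"
  unfolding d_def using conn[OF assms] by (metis LeastI_ex rtrancl_power)

lemma d_sym: "d u v = d v u"
proof -
  have "(u, v) \<in> E ^^ n \<longleftrightarrow> (v, u) \<in> E ^^ n" for n
    using sym_relpow[OF sym_E] by blast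
  then show ?thesis by (simp add: d_def)
qed

lemma d_self [simp]: "d u u = 0"
  using d_le[of u u 0] by simp

lemma d_0D: "u \<in> V \<Longrightarrow> v \<in> V \<Longrightarrow> d u v = 0 \<Longrightarrow> u = v"
  using d_walk by fastforce

lemma d_triangle:
  assumes "u \<in> V" "v \<in> V" "w \<in> V"
  shows "d u w \<le> d u v + d v w"
  using relpow_trans[OF d_walk d_walk] assms by (intro d_le) blast

lemma d_edge: "(u, v) \<in> E \<Longrightarrow> d u v = 1"
  using d_le[of u v 1] d_0D[of u v] E_V irrefl_E
  by (metis One_nat_def le_SucE le_zero_eq relpow_1)

lemma d_1D: "u \<in> V \<Longrightarrow> v \<in> V \<Longrightarrow> d u v = 1 \<Longrightarrow> (u, v) \<in> E"
  using d_walk by fastforce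

lemma d_edge_le: "(u, a) \<in> E \<Longrightarrow> v \<in> V \<Longrightarrow> d u v \<le> Suc (d a v)"
  using d_triangle[of u a v] d_edge[of u a] E_V by auto

lemma d_edge_le': "(u, a) \<in> E \<Longrightarrow> v \<in> V \<Longrightarrow> d a v \<le> Suc (d u v)"
  using d_edge_le E_sym by blast

lemma d_next:
  assumes "u \<in> V" "v \<in> V" "d u v = Suc n"
  obtains a where "(u, a) \<in> E" "d a v = n"
proof -
  have "(u, v) \<in> E ^^ Suc n" using d_walk assms by metis
  then obtain a where a: "(u, a) \<in> E" "(a, v) \<in> E ^^ n"
    by (rule relpow_Suc_E2)
  then have "d a v \<le> n" "Suc n \<le> Suc (d a v)"
    using d_le d_edge_le assms by metis+
  with a that show ?thesis by simp
qed

text \<open>Along a geodesic to \<open>b\<close> the distance to \<open>b\<close> only decreases, so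
  it never meets a vertex \<open>x\<close> that is farther from \<open>b\<close> than its start.
  This supplies the walks avoiding \<open>x\<close> that close up to cycles through
  \<open>x\<close>.\<close>

lemma d_walk_avoiding:
  assumes "a \<in> V" "b \<in> V" "x \<in> V" "d a b < d x b"
  shows "(a, b) \<in> avoiding x ^^ d a b"
  using assms
proof (induction "d a b" arbitrary: a)
  case 0
  then show ?case using d_0D by (metis relpow_0_I)
next
  case (Suc n)
  then obtain a' where a': "(a, a') \<in> E" "d a' b = n" by (metis d_next)
  then have "a' \<in> V" "a \<noteq> x" "a' \<noteq> x" using Suc E_V by auto
  moreover have "(a', b) \<in> avoiding x ^^ n"
    using Suc.hyps(1)[of a'] Suc.hyps(2) Suc.prems a' \<open>a' \<in> V\<close> by auto
  ultimately have "(a, b) \<in> avoiding x ^^ Suc n"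
    using a' by (intro relpow_Suc_I2) auto
  then show ?case using Suc.hyps(2) by simp
qed

section \<open>Unique geodesics, claws and cut vertices\<close>

text \<open>Equivalent to being geodetic: the next vertex on the way to a target is unique.\<close>

definition unique_next :: bool where
  "unique_next \<longleftrightarrow> (\<forall>u v a b. (u, a) \<in> E \<and> (u, b) \<in> E \<and> v \<in> V \<and>
     Suc (d a v) = d u v \<and> Suc (d b v) = d u v \<longrightarrow> a = b)"

definition claw_free :: bool where
  "claw_free \<longleftrightarrow> (\<forall>x a b c. (x, a) \<in> E \<and> (x, b) \<in> E \<and> (x, c) \<in> E \<longrightarrow>
     a = b \<or> a = c \<or> b = c \<or> (a, b) \<in> E \<or> (a, c) \<in> E \<or> (b, c) \<in> E)"

text \<open>This says that every cycle is contained in a clique.\<close>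

definition clique_blocks :: bool where
  "clique_blocks \<longleftrightarrow> (\<forall>v u w. (v, u) \<in> E \<and> (v, w) \<in> E \<and> (u, w) \<in> (avoiding v)\<^sup>* \<longrightarrow>
     u = w \<or> (u, w) \<in> E)"

text \<open>The same for cycles with fewer than \<^term>\<open>n + 2\<close> vertices.\<close>

definition cliques_upto :: "nat \<Rightarrow> bool" where
  "cliques_upto n \<longleftrightarrow> (\<forall>v u w l. (v, u) \<in> E \<and> (v, w) \<in> E \<and> l < n \<and>
     (u, w) \<in> avoiding v ^^ l \<longrightarrow> u = w \<or> (u, w) \<in> E)"

text \<open>Indexing by all integers with period \<open>k\<close> turns rotations and reflections
  into substitutions \<open>j + i\<close> and \<open>j - i\<close>. The distance formula already
  makes \<open>c\<close> injective on a period and free of chords.\<close>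

definition isometric_cycle :: "(int \<Rightarrow> 'a) \<Rightarrow> nat \<Rightarrow> bool" where
  "isometric_cycle c k \<longleftrightarrow> 3 \<le> k \<and> (\<forall>i. (c i, c (i + 1)) \<in> E) \<and> (\<forall>i. c (i + int k) = c i) \<and>
     (\<forall>i s. s \<le> k \<longrightarrow> d (c i) (c (i + int s)) = min s (k - s))"

lemma unique_nextD:
  assumes unique_next "(u, a) \<in> E" "(u, b) \<in> E" "v \<in> V" "Suc (d a v) = d u v" "Suc (d b v) = d u v"
  shows "a = b"
  using assms unfolding unique_next_def by metis

lemma claw_freeD:
  assumes claw_free "(x, a) \<in> E" "(x, b) \<in> E" "(x, c) \<in> E"
  shows "a = b \<or> a = c \<or> b = c \<or> (a, b) \<in> E \<or> (a, c) \<in> E \<or> (b, c) \<in> E"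
  using assms unfolding claw_free_def by metis

lemma clique_blocksD:
  assumes clique_blocks "(v, u) \<in> E" "(v, w) \<in> E" "(u, w) \<in> (avoiding v)\<^sup>*"
  shows "u = w \<or> (u, w) \<in> E"
  using assms unfolding clique_blocks_def by metis

lemma cliques_uptoD:
  assumes "cliques_upto n" "(v, u) \<in> E" "(v, w) \<in> E" "(u, w) \<in> avoiding v ^^ l" "l < n"
  shows "u = w \<or> (u, w) \<in> E"
  using assms unfolding cliques_upto_def by metis

lemma d_eq_2:
  assumes "(u, a) \<in> E" "(a, w) \<in> E" "u \<noteq> w" "(u, w) \<notin> E"
  shows "d u w = 2"
proof -
  have "d u w \<le> 2" "d u w \<noteq> 0" "d u w \<noteq> 1"
    using d_edge_le[of u a w] d_edge[of a w] d_0D[of u w] d_1D[of u w] assms E_V by auto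
  then show ?thesis by linarith
qed

text \<open>Different common neighbours would be the midpoints of two geodesics of length 2. In this
  form uniqueness of geodesics rules out induced 4-cycles.\<close>

lemma unique_common_neighbour:
  assumes unique_next "(u, a) \<in> E" "(a, w) \<in> E" "(u, b) \<in> E" "(b, w) \<in> E" "u \<noteq> w" "(u, w) \<notin> E"
  shows "a = b"
  using assms d_eq_2[of u a w] d_edge[of a w] d_edge[of b w] E_V
  by (intro unique_nextD[of u a b w]) auto

section \<open>Isometric cycles and their symmetries\<close>

lemma isometric_cycleD:
  assumes "isometric_cycle c k"
  shows "3 \<le> k" "(c i, c (i + 1)) \<in> E" "c (i + int k) = c i"
    "s \<le> k \<Longrightarrow> d (c i) (c (i + int s)) = min s (k - s)"
  using assms unfolding isometric_cycle_def by auto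

lemma isometric_cycle_V: "isometric_cycle c k \<Longrightarrow> c i \<in> V"
  using isometric_cycleD(2) E_V by metis

lemma isometric_cycle_d:
  assumes "isometric_cycle c k" "j - i = int s" "s \<le> k"
  shows "d (c i) (c j) = min s (k - s)"
  using isometric_cycleD(4)[OF assms(1,3), of i] assms(2) by (simp add: algebra_simps)

lemma isometric_cycle_shift:
  assumes "isometric_cycle c k"
  shows "isometric_cycle (\<lambda>i. c (j + i)) k"
  using assms unfolding isometric_cycle_def by (simp add: add.assoc[symmetric])

lemma isometric_cycle_reflect:
  assumes "isometric_cycle c k"
  shows "isometric_cycle (\<lambda>i. c (j - i)) k"
  unfolding isometric_cycle_def
proof (intro conjI allI impI)
  show "3 \<le> k" using assms by (rule isometric_cycleD)
  show "(c (j - i), c (j - (i + 1))) \<in> E" for i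
    using isometric_cycleD(2)[OF assms, of "j - (i + 1)"] by (simp add: E_sym)
  show "c (j - (i + int k)) = c (j - i)" for i
    using isometric_cycleD(3)[OF assms, of "j - (i + int k)"] by simp
  show "d (c (j - i)) (c (j - (i + int s))) = min s (k - s)" if "s \<le> k" for i s
    using isometric_cycle_d[OF assms, of "j - i" "j - (i + int s)" s] that by (simp add: d_sym)
qed

text \<open>
  A vertex \<open>r\<close> starting a shortcut from \<open>c i\<close> would close, together with each of the two arcs,
  a cycle shorter than \<open>k\<close>; so it is adjacent to both \<open>c (i - 1)\<close> and \<open>c (i + 1)\<close>.
\<close>

lemma isometric_cycleI:
  fixes c :: "int \<Rightarrow> 'a"
  assumes un: unique_next
    and small: "cliques_upto (k - 2)" and k: "4 \<le> k"
    and edge: "\<And>i. (c i, c (i + 1)) \<in> E"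
    and per: "\<And>i. c (i + int k) = c i"
    and inj: "\<And>i s. 0 < s \<Longrightarrow> s < k \<Longrightarrow> c i \<noteq> c (i + int s)"
    and induced: "\<And>i. (c i, c (i + 2)) \<notin> E"
  shows "isometric_cycle c k"
proof -
  have V: "c i \<in> V" for i using edge E_V by blast
  have arc: "(c i, c (i + int s)) \<in> E ^^ s" for i s
    using edge by (intro relpow_int_seq)
  \<comment> \<open>The two arcs bound the distance from above, so only shortcuts have to be
    excluded. The induction is on the distance, for all pairs on the cycle at once.\<close>
  have lower: "min s (k - s) \<le> d (c i) (c (i + int s))" if "s \<le> k" for i s
    using that
  proof (induction "d (c i) (c (i + int s))" arbitrary: i s rule: less_induct)
    case less
    let ?a = "c i" and ?b = "c (i + int s)"
    show ?case
    proof (rule ccontr)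
      assume "\<not> min s (k - s) \<le> d ?a ?b"
      then have lt: "d ?a ?b < s" "d ?a ?b < k - s" "0 < s" "s < k" by auto
      have "?a \<noteq> ?b" using inj lt by blast
      then obtain e where e: "d ?a ?b = Suc e" using d_0D V by (metis not0_implies_Suc)
      then obtain r where r: "(?a, r) \<in> E" "d r ?b = e" using d_next V by metis
      have rV: "r \<in> V" using r E_V by blast
      have rb: "(r, ?b) \<in> avoiding ?a ^^ e"
        using d_walk_avoiding[of r ?b ?a] rV V r e by auto
      have i1: "c (i + int k - 1) = c (i - 1)" using per[of "i - 1"] by (simp add: algebra_simps)
      have "(c (i + 1), c (i + 1 + int (s - 1))) \<in> avoiding ?a ^^ (s - 1)"
      proof (rule relpow_int_seq)
        fix t assume "t < s - 1"
        then have "?a \<noteq> c (i + int (t + 1))" "?a \<noteq> c (i + int (t + 2))"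
          using lt by (intro inj; simp)+
        moreover have "i + 1 + int t = i + int (t + 1)" "i + 1 + int t + 1 = i + int (t + 2)"
          by simp_all
        ultimately show "(c (i + 1 + int t), c (i + 1 + int t + 1)) \<in> avoiding ?a"
          using edge[of "i + 1 + int t"] by (metis ComplI IntI mem_Sigma_iff singletonD)
      qed
      moreover have "i + 1 + int (s - 1) = i + int s" using lt by simp
      ultimately have "(c (i + 1), ?b) \<in> avoiding ?a ^^ (s - 1)" by (simp only:)
      then have "(?b, c (i + 1)) \<in> avoiding ?a ^^ (s - 1)" by (rule sym_relpow[OF sym_avoiding])
      with rb have "(r, c (i + 1)) \<in> avoiding ?a ^^ (e + (s - 1))" by (rule relpow_trans)
      \<comment> \<open>The walk has fewer than \<open>k - 2\<close> steps because the shortcut, of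
        length \<open>e + 1\<close>, is shorter than the arc of length \<open>k - s\<close> that it
        replaces. For \<open>n2\<close> the arc replaced is the one of length
        \<open>s\<close>.\<close>
      then have n1: "r = c (i + 1) \<or> (r, c (i + 1)) \<in> E"
        using lt e by (intro cliques_uptoD[OF small r(1) edge]) auto
      have "(?b, c (i + int s + int (k - 1 - s))) \<in> avoiding ?a ^^ (k - 1 - s)"
      proof (rule relpow_int_seq)
        fix t assume "t < k - 1 - s"
        then have "?a \<noteq> c (i + int (s + t))" "?a \<noteq> c (i + int (s + t + 1))"
          using lt by (intro inj; simp)+
        moreover have "i + int s + int t = i + int (s + t)" "i + int s + int t + 1 = i + int (s + t + 1)"
          by simp_all
        ultimately show "(c (i + int s + int t), c (i + int s + int t + 1)) \<in> avoiding ?a"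
          using edge[of "i + int s + int t"] by (metis ComplI IntI mem_Sigma_iff singletonD)
      qed
      moreover have "i + int s + int (k - 1 - s) = i + int k - 1" using lt by simp
      ultimately have "(?b, c (i - 1)) \<in> avoiding ?a ^^ (k - 1 - s)" using i1 by (simp only:)
      with rb have "(r, c (i - 1)) \<in> avoiding ?a ^^ (e + (k - 1 - s))" by (rule relpow_trans)
      moreover have "(?a, c (i - 1)) \<in> E" using edge[of "i - 1"] E_sym by simp
      ultimately have n2: "r = c (i - 1) \<or> (r, c (i - 1)) \<in> E"
        using lt e by (intro cliques_uptoD[OF small r(1)]) auto
      \<comment> \<open>If \<open>r\<close> is a cycle neighbour of \<open>c i\<close>, the
        induction hypothesis applies to \<open>r\<close> and \<open>?b\<close>, which are at
        distance \<open>e\<close>. Otherwise \<open>r\<close> and \<open>c i\<close> are two common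
        neighbours of the nonadjacent vertices \<open>c (i - 1)\<close> and
        \<open>c (i + 1)\<close>.\<close>
      consider "r = c (i + 1)" | "r = c (i - 1)" | "(r, c (i + 1)) \<in> E" "(r, c (i - 1)) \<in> E"
        using n1 n2 by blast
      then show False
      proof cases
        case 1
        have b: "i + 1 + int (s - 1) = i + int s" using lt by simp
        have "min (s - 1) (k - (s - 1)) \<le> d (c (i + 1)) (c (i + 1 + int (s - 1)))"
          using r e 1 \<open>s < k\<close> unfolding b by (intro less.hyps[of "i + 1" "s - 1", unfolded b]) simp_all
        then have "min (s - 1) (k - (s - 1)) \<le> e" using r unfolding b 1 by simp
        then show False using lt e by linarith
      next
        case 2
        have b: "i - 1 + int (s + 1) = i + int s" by simp
        have "min (s + 1) (k - (s + 1)) \<le> d (c (i - 1)) (c (i - 1 + int (s + 1)))"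
          using r e 2 \<open>s < k\<close> unfolding b by (intro less.hyps[of "i - 1" "s + 1", unfolded b]) simp_all
        then have "min (s + 1) (k - (s + 1)) \<le> e" using r unfolding b 2 by simp
        then show False using lt e by linarith
      next
        case 3
        have "c (i - 1) \<noteq> c (i + 1)" "(c (i - 1), c (i + 1)) \<notin> E"
          using inj[of 2 "i - 1"] induced[of "i - 1"] k by (auto simp: algebra_simps)
        then have "r = ?a"
          using 3 edge[of "i - 1"] edge[of i]
          by (intro unique_common_neighbour[OF un E_sym]) simp_all
        then show False using r irrefl_E by blast
      qed
    qed
  qed
  have "d (c i) (c (i + int s)) = min s (k - s)" if s: "s \<le> k" for i s
  proof -
    have "d (c i) (c (i + int s)) \<le> s" using arc by (rule d_le)
    moreover have "(c (i + int s), c (i + int s + int (k - s))) \<in> E ^^ (k - s)" by (rule arc)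
    moreover have "c (i + int s + int (k - s)) = c i" using per s by (simp add: of_nat_diff)
    ultimately have "d (c i) (c (i + int s)) \<le> s" "d (c i) (c (i + int s)) \<le> k - s"
      using d_le[of "c (i + int s)" "c i"] d_sym[of "c i" "c (i + int s)"] by simp_all
    then show ?thesis using lower[OF s, of i] by linarith
  qed
  then show ?thesis
    unfolding isometric_cycle_def using k edge per by auto
qed

text \<open>A shortcut in the walk from \<open>u\<close> to \<open>w\<close> would give a shorter
  walk, for which \<open>small\<close> yields \<open>u = w\<close> or an edge. So the walk is an
  induced path, and closing it through \<open>v\<close> gives a sequence to which
  \<open>isometric_cycleI\<close> applies.\<close>

lemma minimal_counterexample_cycle:
  assumes un: unique_next
    and small: "cliques_upto n"
    and v: "(v, u) \<in> E" "(v, w) \<in> E" and uw: "(u, w) \<in> avoiding v ^^ n" "u \<noteq> w" "(u, w) \<notin> E"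
  shows "\<exists>c. isometric_cycle c (n + 2)"
proof -
  obtain f where f: "f 0 = u" "f n = w" and fE: "\<And>i. i < n \<Longrightarrow> (f i, f (Suc i)) \<in> avoiding v"
    using uw(1) unfolding relpow_fun_conv by blast
  have "n \<noteq> 0" using uw by (intro notI) simp
  moreover have "n \<noteq> 1" using uw by (intro notI) simp
  ultimately have n2: "2 \<le> n" by linarith
  have fv: "f i \<noteq> v" if "i \<le> n" for i
    using that fE[of i] fE[of "i - 1"] n2 by (cases "i < n") auto
  have path: "(f i, f j) \<in> avoiding v ^^ (j - i)" if "i \<le> j" "j \<le> n" for i j
    using that fE by (intro relpow_nat_seq) auto
  \<comment> \<open>The cases \<open>l = 0\<close> and \<open>l = 1\<close> exclude repeated
    vertices and chords.\<close>
  have short: False if "(f i, f j) \<in> avoiding v ^^ l" "i + l < j" "j \<le> n" for i j l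
  proof -
    have "(u, f i) \<in> avoiding v ^^ i" "(f j, w) \<in> avoiding v ^^ (n - j)"
      using path[of 0 i] path[of j n] that f by auto
    then have "(u, w) \<in> avoiding v ^^ (i + l + (n - j))"
      using relpow_trans[OF relpow_trans[OF _ that(1)]] by blast
    moreover have "i + l + (n - j) < n" using that by linarith
    ultimately show False
      using cliques_uptoD[OF small v] uw by blast
  qed
  have finj: "f i \<noteq> f j" if "i < j" "j \<le> n" for i j
    using short[of i j 0] that by auto
  have fnadj: "(f i, f j) \<notin> E" if "i + 1 < j" "j \<le> n" for i j
    using short[of i j 1] that fv by auto
  \<comment> \<open>If \<open>v\<close> were adjacent to \<open>f 1\<close>, the shorter walk from
    \<open>f 1\<close> to \<open>w\<close> would make these two adjacent, and \<open>f 1\<close> and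
    \<open>v\<close> would be two common neighbours of \<open>u\<close> and \<open>w\<close>. The
    fact \<open>v_last\<close> is the mirror image.\<close>
  have v_first: "(v, f 1) \<notin> E"
  proof
    assume a: "(v, f 1) \<in> E"
    have "(f 1, w) \<in> avoiding v ^^ (n - 1)" using path[of 1 n] f n2 by simp
    then have "f 1 = w \<or> (f 1, w) \<in> E" using cliques_uptoD[OF small a v(2)] n2 by simp
    moreover have "f 1 \<noteq> w" using finj[of 1 n] f n2 by simp
    moreover have "(u, f 1) \<in> E" using fE[of 0] f n2 by auto
    ultimately have "f 1 = v"
      using unique_common_neighbour[OF un, of u "f 1" w v] v uw E_sym by blast
    then show False using fv[of 1] n2 by simp
  qed
  have v_last: "(v, f (n - 1)) \<notin> E"
  proof
    assume a: "(v, f (n - 1)) \<in> E"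
    have "(u, f (n - 1)) \<in> avoiding v ^^ (n - 1)" using path[of 0 "n - 1"] f n2 by simp
    then have "u = f (n - 1) \<or> (u, f (n - 1)) \<in> E" using cliques_uptoD[OF small v(1) a] n2 by simp
    moreover have "u \<noteq> f (n - 1)" using finj[of 0 "n - 1"] f n2 by simp
    moreover have "(f (n - 1), w) \<in> E" using fE[of "n - 1"] f n2 by auto
    ultimately have "f (n - 1) = v"
      using unique_common_neighbour[OF un, of u "f (n - 1)" w v] v uw E_sym by blast
    then show False using fv[of "n - 1"] n2 by simp
  qed
  define k where "k = n + 2"
  \<comment> \<open>The cycle is \<open>v\<close>, \<open>f 0\<close>, ..., \<open>f n\<close> at
    positions \<open>0\<close> to \<open>n + 1\<close>; \<open>c\<close> extends it
    periodically.\<close>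
  define g where "g r = (if r = 0 then v else f (r - 1))" for r :: nat
  define c where "c i = g (nat (i mod int k))" for i
  have k: "4 \<le> k" using n2 by (simp add: k_def)
  have gE: "(g r, g (Suc r mod k)) \<in> E" if "r < k" for r
  proof -
    have "r = 0 \<or> r = n + 1 \<or> 0 < r \<and> r \<le> n" using that k_def by linarith
    then consider "r = 0" | "r = n + 1" | "0 < r" "r \<le> n" by blast
    then show ?thesis
    proof cases
      case 1 then show ?thesis using v f k by (simp add: g_def)
    next
      case 2 then show ?thesis using v f by (simp add: g_def k_def E_sym)
    next
      case 3
      then show ?thesis using fE[of "r - 1"] by (auto simp: g_def k_def)
    qed
  qed
  have ginj: "g r \<noteq> g s" if "r < s" "s < k" for r s
  proof -
    have "s - 1 \<le> n" "r \<noteq> 0 \<Longrightarrow> r - 1 < s - 1" using that k_def by linarith+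
    then show ?thesis using that fv[of "s - 1"] finj[of "r - 1" "s - 1"] by (auto simp: g_def)
  qed
  \<comment> \<open>The first three cases are the chords that involve or span \<open>v\<close>: from
    \<open>v\<close> to \<open>f 1\<close>, from \<open>f (n - 1)\<close> to \<open>v\<close>, and
    from \<open>w\<close> to \<open>u\<close>.\<close>
  have gnadj: "(g r, g ((r + 2) mod k)) \<notin> E" if "r < k" for r
  proof -
    have "r = 0 \<or> r = n \<or> r = n + 1 \<or> 0 < r \<and> r < n" using that k_def by linarith
    then consider "r = 0" | "r = n" | "r = n + 1" | "0 < r" "r < n" by blast
    then show ?thesis
    proof cases
      case 1 then show ?thesis using v_first k by (simp add: g_def)
    next
      case 2 then show ?thesis using v_last n2 E_sym by (auto simp: g_def k_def)
    next
      case 3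
      then have "(r + 2) mod k = 1" by (simp add: k_def mod_if)
      then show ?thesis using 3 f uw E_sym by (auto simp: g_def)
    next
      case 4
      then show ?thesis using fnadj[of "r - 1" "r + 1"] by (auto simp: g_def k_def)
    qed
  qed
  have c_add: "c (i + int a) = g ((nat (i mod int k) + a) mod k)" for i a
  proof -
    have "(i + int a) mod int k = int ((nat (i mod int k) + a) mod k)"
      using k by (simp add: zmod_int mod_add_left_eq)
    then show ?thesis by (simp add: c_def)
  qed
  have lt: "nat (i mod int k) < k" for i
    using k by (simp add: nat_less_iff)
  have "isometric_cycle c k"
  proof (rule isometric_cycleI[OF un _ k])
    show "cliques_upto (k - 2)" using small by (simp add: k_def)
    show "(c i, c (i + 1)) \<in> E" for i
      using gE[OF lt[of i]] c_add[of i 1] by (simp add: c_def[of i])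
    show "c (i + int k) = c i" for i by (simp add: c_def)
    show "(c i, c (i + 2)) \<notin> E" for i
      using gnadj[OF lt[of i]] c_add[of i 2] by (simp add: c_def[of i])
    show "c i \<noteq> c (i + int s)" if s: "0 < s" "s < k" for i s
    proof -
      let ?r = "nat (i mod int k)"
      have "(?r + s) mod k \<noteq> ?r"
      proof (cases "?r + s < k")
        case False
        then have "(?r + s) mod k = ?r + s - k"
          using lt[of i] s by (simp add: mod_if)
        then show ?thesis using s False by linarith
      qed (use s in simp)
      moreover have "(?r + s) mod k < k" using k by simp
      ultimately have "g ?r \<noteq> g ((?r + s) mod k)"
        using ginj[of ?r "(?r + s) mod k"] ginj[of "(?r + s) mod k" ?r] lt[of i]
        by (metis linorder_neqE_nat)
      then show ?thesis using c_add by (simp add: c_def[of i])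
    qed
  qed
  then show ?thesis by (auto simp: k_def)
qed

text \<open>Both cycle neighbours of \<open>c 0\<close> are one step closer to its antipode
  \<open>c (int m)\<close>, so uniqueness would identify \<open>c (- 1)\<close> with
  \<open>c 1\<close>.\<close>

lemma isometric_cycle_odd:
  assumes un: unique_next and c: "isometric_cycle c k"
  shows "odd k"
proof
  assume "even k"
  then obtain m where m: "k = 2 * m" by blast
  have m2: "2 \<le> m" using isometric_cycleD(1)[OF c] m by linarith
  have "c (- 1) = c 1"
  proof (rule unique_nextD[OF un, of "c 0" _ _ "c (int m)"])
    show "(c 0, c (- 1)) \<in> E" using isometric_cycleD(2)[OF c, of "- 1"] by (simp add: E_sym)
    show "(c 0, c 1) \<in> E" using isometric_cycleD(2)[OF c, of 0] by simp
    show "c (int m) \<in> V" using c by (rule isometric_cycle_V)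
    have "d (c 0) (c (int m)) = m" "d (c (- 1)) (c (int m)) = m - 1" "d (c 1) (c (int m)) = m - 1"
      using isometric_cycle_d[OF c, of "int m" 0 m] isometric_cycle_d[OF c, of "int m" "- 1" "m + 1"]
        isometric_cycle_d[OF c, of "int m" 1 "m - 1"] m m2 by auto
    then show "Suc (d (c (- 1)) (c (int m))) = d (c 0) (c (int m))"
      "Suc (d (c 1) (c (int m))) = d (c 0) (c (int m))" using m2 by auto
  qed
  then show False using isometric_cycle_d[OF c, of 1 "- 1" 2] m m2 by simp
qed

text \<open>The geodesic from \<open>x\<close> to \<open>y\<close> and the arc from
  \<open>c 1\<close> to \<open>c (int m)\<close> are joined at both ends by edges to a cycle of
  length \<open>2 * m\<close>, one less than the length of \<open>c\<close>. Hence
  \<open>small\<close> attaches the first inner vertex \<open>p\<close> to \<open>c 1\<close>.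
  Uniqueness of geodesics from \<open>c 1\<close> to \<open>c (int m + 1)\<close> forces
  \<open>p = c 2\<close>, and then \<open>x\<close> and \<open>c 1\<close> are both common
  neighbours of \<open>c 0\<close> and \<open>c 2\<close>.\<close>

lemma no_ladder:
  assumes un: unique_next and c: "isometric_cycle c (2 * m + 1)" and m: "2 \<le> m"
    and small: "cliques_upto (2 * m - 1)"
    and x: "x \<notin> range c" "(x, c 0) \<in> E" "(x, c 1) \<in> E"
    and y: "(y, c (int m + 1)) \<in> E" "Suc (d x y) = m" "(y, c (int m)) \<in> E"
  shows False
proof -
  have xV: "x \<in> V" and yV: "y \<in> V" using x y E_V by blast+
  note cV = isometric_cycle_V[OF c] and cd = isometric_cycle_d[OF c]
  have "d x y = Suc (m - 2)" using y m by simp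
  then obtain p where p: "(x, p) \<in> E" "d p y = m - 2" using d_next xV yV by metis
  have pV: "p \<in> V" using p E_V by blast
  have "(p, y) \<in> avoiding x ^^ (m - 2)"
    using d_walk_avoiding[of p y x] p pV xV yV \<open>d x y = Suc _\<close> by simp
  moreover have "(y, c (int m)) \<in> avoiding x ^^ 1"
    using y x \<open>d x y = Suc _\<close> by auto
  moreover have "(c (int m), c 1) \<in> avoiding x ^^ (m - 1)"
  proof (rule sym_relpow[OF sym_avoiding])
    have "(c 1, c (1 + int (m - 1))) \<in> avoiding x ^^ (m - 1)"
      using isometric_cycleD(2)[OF c, of "1 + int t" for t] x
      by (intro relpow_int_seq) (auto simp: algebra_simps)
    then show "(c 1, c (int m)) \<in> avoiding x ^^ (m - 1)" using m by (simp add: of_nat_diff)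
  qed
  ultimately have "(p, c 1) \<in> avoiding x ^^ (m - 2 + 1 + (m - 1))"
    by (blast intro: relpow_trans)
  then have pc1: "p = c 1 \<or> (p, c 1) \<in> E"
    by (rule cliques_uptoD[OF small p(1) x(3)]) (use m in simp)
  have c1: "d (c 1) (c (int m + 1)) = m" using cd[of "int m + 1" 1 m] m by simp
  have "d p (c (int m + 1)) \<le> m - 2 + 1"
    using d_triangle[OF pV yV cV] d_edge[OF y(1)] p by metis
  then have pm: "d p (c (int m + 1)) \<le> m - 1" using m by linarith
  then have "p \<noteq> c 1" using c1 m by auto
  then have pE: "(c 1, p) \<in> E" using pc1 E_sym by blast
  then have "Suc (d p (c (int m + 1))) = d (c 1) (c (int m + 1))"
    using d_edge_le[OF pE cV[of "int m + 1"]] pm c1 m by linarith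
  moreover have "Suc (d (c 2) (c (int m + 1))) = d (c 1) (c (int m + 1))"
    using cd[of "int m + 1" 2 "m - 1"] c1 m by simp
  ultimately have "p = c 2"
    using unique_nextD[OF un pE _ cV, of "c 2"] isometric_cycleD(2)[OF c, of 1] by simp
  then have "(x, c 2) \<in> E" using p by simp
  moreover have "d (c 0) (c 2) = 2" using cd[of 2 0 2] m by simp
  ultimately have "x = c 1"
    using x E_sym isometric_cycleD(2)[OF c, of 0] isometric_cycleD(2)[OF c, of 1] d_edge[of "c 0" "c 2"]
    by (intro unique_common_neighbour[OF un, of "c 0" x "c 2"]) auto
  then show False using x by blast
qed

text \<open>Let \<open>y\<close> be the next vertex from the opposite vertex \<open>?t\<close>
  towards \<open>x\<close>. To avoid a claw at \<open>?t\<close>, it must be adjacent to one of the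
  two cycle neighbours of \<open>?t\<close>; both cases are ladders, exchanged by a
  reflection.\<close>

lemma no_vertex_on_cycle_edge:
  assumes un: unique_next and cf: claw_free
    and c: "isometric_cycle c (2 * m + 1)" and m: "2 \<le> m"
    and small: "cliques_upto (2 * m - 1)"
    and x: "x \<notin> range c" "(x, c 0) \<in> E" "(x, c 1) \<in> E"
  shows False
proof -
  note cE = isometric_cycleD(2)[OF c] and cV = isometric_cycle_V[OF c] and cd = isometric_cycle_d[OF c]
  have xV: "x \<in> V" using x E_V by blast
  let ?t = "c (int m + 1)"
  have c0: "d (c 0) ?t = m" and c1: "d (c 1) ?t = m"
    using cd[of "int m + 1" 0 "m + 1"] cd[of "int m + 1" 1 m] m by auto
  have c0E: "(c 0, c 1) \<in> E" and c1E: "(c 1, c 2) \<in> E"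
    using cE[of 0] cE[of 1] by simp_all
  have c01: "c 0 \<noteq> c 1" using cE[of 0] irrefl_E by auto
  \<comment> \<open>Distance \<open>m + 1\<close> would give \<open>x\<close> the two next vertices
    \<open>c 0\<close> and \<open>c 1\<close> towards \<open>?t\<close>; distance
    \<open>m - 1\<close> would give \<open>c 1\<close> the two next vertices \<open>x\<close> and
    \<open>c 2\<close>.\<close>
  have "d x ?t \<le> Suc m" "m \<le> Suc (d x ?t)"
    using d_edge_le[OF x(2) cV] d_edge_le'[OF x(2) cV] c0 by metis+
  moreover have "d x ?t \<noteq> Suc m"
    using unique_nextD[OF un x(2,3) cV[of "int m + 1"]] c0 c1 c01 by auto
  moreover have "Suc (d x ?t) \<noteq> m"
  proof
    assume "Suc (d x ?t) = m"
    moreover have "Suc (d (c 2) ?t) = d (c 1) ?t"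
      using cd[of "int m + 1" 2 "m - 1"] c1 m by simp
    ultimately have "x = c 2"
      using unique_nextD[OF un E_sym[OF x(3)] c1E cV] c1 by metis
    then show False using x by blast
  qed
  ultimately have "d x ?t = m" by linarith
  then have "d ?t x = Suc (m - 1)" using m by (simp add: d_sym)
  then obtain y where y: "(?t, y) \<in> E" "d y x = m - 1" using d_next xV cV by metis
  have yx: "Suc (d x y) = m" using y m d_sym by simp
  \<comment> \<open>The reflection exchanging \<open>c 0\<close> and \<open>c 1\<close> fixes
    \<open>?t\<close> and exchanges its neighbours \<open>c (int m)\<close> and
    \<open>c (int m + 2)\<close>.\<close>
  have per: "c (1 - int m) = c (int m + 2)" "c (- int m) = ?t"
    using isometric_cycleD(3)[OF c, of "1 - int m"] isometric_cycleD(3)[OF c, of "- int m"]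
    by (simp_all add: algebra_simps)
  have tm: "(?t, c (int m)) \<in> E" using cE[of "int m"] by (simp add: E_sym)
  have tm2: "(?t, c (int m + 2)) \<in> E" using cE[of "int m + 1"] by (simp add: algebra_simps)
  have far: "d (c (int m)) (c (int m + 2)) = 2" using cd[of "int m + 2" "int m" 2] m by simp
  \<comment> \<open>Otherwise \<open>x\<close> and \<open>c 1\<close> would both be next from
    \<open>c 0\<close> towards \<open>c (int m)\<close>; \<open>ym2\<close> is symmetric.\<close>
  have ym: "y \<noteq> c (int m)"
  proof
    assume "y = c (int m)"
    then have "Suc (d x (c (int m))) = d (c 0) (c (int m))" "Suc (d (c 1) (c (int m))) = d (c 0) (c (int m))"
      using yx cd[of "int m" 0 m] cd[of "int m" 1 "m - 1"] m by auto
    then have "x = c 1"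
      using unique_nextD[OF un E_sym[OF x(2)] c0E cV] by blast
    then show False using x by blast
  qed
  have ym2: "y \<noteq> c (int m + 2)"
  proof
    assume "y = c (int m + 2)"
    then have "Suc (d x (c (int m + 2))) = d (c 1) (c (int m + 2))"
      "Suc (d (c 0) (c (int m + 2))) = d (c 1) (c (int m + 2))"
      using yx cd[of "int m + 2" 1 "m + 1"] cd[of "int m + 2" 0 "m + 2"] m by auto
    then have "x = c 0"
      using unique_nextD[OF un E_sym[OF x(3)] E_sym[OF c0E] cV] by blast
    then show False using x by blast
  qed
  have "(y, c (int m)) \<in> E \<or> (y, c (int m + 2)) \<in> E"
    using claw_freeD[OF cf y(1) tm tm2] ym ym2 far d_edge by fastforce
  then show False
  proof
    assume "(y, c (int m)) \<in> E"
    then show False using no_ladder[OF un c m small x] y yx E_sym by blast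
  next
    assume a: "(y, c (int m + 2)) \<in> E"
    show False
    proof (rule no_ladder[OF un isometric_cycle_reflect[OF c, of 1] m small, of x y])
      show "x \<notin> range (\<lambda>i. c (1 - i))" using x by blast
    qed (use x y yx a per E_sym in auto)
  qed
qed

theorem unique_next_claw_free_cases:
  assumes un: unique_next and cf: claw_free
  shows "(\<exists>c k. odd k \<and> isometric_cycle c k \<and> range c = V) \<or> clique_blocks"
proof (rule disjCI)
  assume "\<not> clique_blocks"
  define P where "P n \<longleftrightarrow> (\<exists>v u w. (v, u) \<in> E \<and> (v, w) \<in> E \<and>
    (u, w) \<in> avoiding v ^^ n \<and> u \<noteq> w \<and> (u, w) \<notin> E)" for n
  from \<open>\<not> clique_blocks\<close> have "\<exists>n. P n"
    unfolding clique_blocks_def P_def rtrancl_power by blast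
  then obtain n where n: "P n" and min: "\<And>l. l < n \<Longrightarrow> \<not> P l"
    by (metis exists_least_iff)
  have small: "cliques_upto n"
    using min unfolding cliques_upto_def P_def by blast
  from n obtain c where c: "isometric_cycle c (n + 2)"
    unfolding P_def using minimal_counterexample_cycle[OF un small] by blast
  from isometric_cycle_odd[OF un c] obtain m where m: "n + 2 = 2 * m + 1" by (metis oddE)
  \<comment> \<open>A walk of length 1 would make \<open>u\<close> and \<open>w\<close> adjacent;
    what remains are odd lengths \<open>n + 2\<close> of at least 5.\<close>
  have "n \<noteq> 1" using n unfolding P_def by auto
  then have m2: "2 \<le> m" using m by presburger
  have nm: "n = 2 * m - 1" using m by simp
  note cE = isometric_cycleD(2)[OF c]
  \<comment> \<open>To avoid a claw at \<open>c i\<close>, an outside neighbour is adjacent to both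
    ends of some cycle edge, and a rotation moves that edge to \<open>c 0\<close>,
    \<open>c 1\<close>.\<close>
  have closed: "x \<in> range c" if "(c i, x) \<in> E" for i x
  proof (rule ccontr)
    assume x: "x \<notin> range c"
    have no: "\<not> ((x, c j) \<in> E \<and> (x, c (j + 1)) \<in> E)" for j
    proof
      assume "(x, c j) \<in> E \<and> (x, c (j + 1)) \<in> E"
      then show False
        using no_vertex_on_cycle_edge[OF un cf, of "\<lambda>i. c (j + i)" m x]
          isometric_cycle_shift[OF c] m m2 small x unfolding nm by auto
    qed
    have "(c i, c (i - 1)) \<in> E" using cE[of "i - 1"] E_sym by simp
    moreover have "d (c (i - 1)) (c (i + 1)) = 2"
      using isometric_cycle_d[OF c, of "i + 1" "i - 1" 2] m m2 by simp
    ultimately have "(x, c (i - 1)) \<in> E \<or> (x, c (i + 1)) \<in> E"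
      using claw_freeD[OF cf that cE, of "c (i - 1)"] x d_edge E_sym by fastforce
    then show False using no[of i] no[of "i - 1"] that E_sym by auto
  qed
  have "v \<in> range c" if "v \<in> V" for v
  proof -
    have "(c 0, v) \<in> E\<^sup>*" using conn isometric_cycle_V[OF c] that by blast
    then show ?thesis by induction (auto intro: closed)
  qed
  then have "range c = V" using isometric_cycle_V[OF c] by blast
  then show "\<exists>c k. odd k \<and> isometric_cycle c k \<and> range c = V"
    using c isometric_cycle_odd[OF un c] by blast
qed

text \<open>Suppose \<open>a\<close> and \<open>b\<close> are different next vertices, and
  \<open>p\<close> follows \<open>a\<close> on a geodesic to \<open>v\<close>. Going from
  \<open>u\<close> through \<open>b\<close> to \<open>v\<close> and back to \<open>p\<close> avoids
  \<open>a\<close>, so \<open>u\<close> and \<open>p\<close> are equal or adjacent. This makes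
  \<open>u\<close> too close to \<open>v\<close>.\<close>

lemma clique_blocks_unique_next:
  assumes cb: clique_blocks
  shows unique_next
  unfolding unique_next_def
proof (intro allI impI, elim conjE, rule ccontr)
  fix u v a b
  assume ab: "(u, a) \<in> E" "(u, b) \<in> E" "v \<in> V" "Suc (d a v) = d u v" "Suc (d b v) = d u v" "a \<noteq> b"
  have V: "u \<in> V" "a \<in> V" "b \<in> V" using ab E_V by blast+
  have "d a v \<noteq> 0" using ab d_0D V by (metis nat.inject)
  then obtain e where e: "d a v = Suc e" by (metis not0_implies_Suc)
  then obtain p where p: "(a, p) \<in> E" "d p v = e" using d_next V ab by metis
  have pV: "p \<in> V" using p E_V by blast
  then obtain q where q: "(b, q) \<in> E" "d q v = e"
    using d_next[of b v e] V ab e by (metis nat.inject)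
  have qV: "q \<in> V" using q E_V by blast
  have "(q, v) \<in> avoiding a ^^ e" "(p, v) \<in> avoiding a ^^ e"
    using d_walk_avoiding[of q v a] d_walk_avoiding[of p v a] V pV qV ab p q e by auto
  then have "(q, p) \<in> avoiding a ^^ (e + e)"
    using sym_relpow[OF sym_avoiding] by (blast intro: relpow_trans)
  then have "(q, p) \<in> (avoiding a)\<^sup>*" by (rule relpow_imp_rtrancl)
  moreover have "(u, b) \<in> avoiding a" "(b, q) \<in> avoiding a"
    using ab q e irrefl_E by auto
  ultimately have "(u, p) \<in> (avoiding a)\<^sup>*"
    by (meson converse_rtrancl_into_rtrancl)
  then have "u = p \<or> (u, p) \<in> E"
    using clique_blocksD[OF cb E_sym[OF ab(1)] p(1)] by blast
  then show False
    using d_edge_le[of u p v] p ab e by auto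
qed

section \<open>Cycles are claw-free, and odd ones have unique geodesics\<close>

lemma cycle_claw_free:
  assumes V: "V = range c"
    and nb: "\<And>i x. (c i, x) \<in> E \<Longrightarrow> x = c (i + 1) \<or> x = c (i - 1)"
  shows claw_free
  unfolding claw_free_def
proof (intro allI impI, elim conjE)
  fix x p q r
  assume x: "(x, p) \<in> E" "(x, q) \<in> E" "(x, r) \<in> E"
  then obtain i where "x = c i" using V E_V by blast
  then have "p = q \<or> p = r \<or> q = r" using nb x by metis
  then show "p = q \<or> p = r \<or> q = r \<or> (p, q) \<in> E \<or> (p, r) \<in> E \<or> (q, r) \<in> E" by blast
qed

text \<open>If both neighbours of \<open>c i\<close> had the smaller distance \<open>D\<close> to
  \<open>c j\<close>, then \<open>i\<close> would be congruent to \<open>j - D - 1\<close> and to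
  \<open>j + D + 1\<close> modulo \<open>k\<close>. As \<open>k\<close> is odd, it divides
  \<open>D + 1\<close>, whence \<open>c i = c j\<close>.\<close>

lemma odd_cycle_unique_next:
  fixes c :: "int \<Rightarrow> 'a"
  assumes V: "V = range c" and k: "odd k"
    and edge: "\<And>i. (c i, c (i + 1)) \<in> E"
    and nb: "\<And>i x. (c i, x) \<in> E \<Longrightarrow> x = c (i + 1) \<or> x = c (i - 1)"
    and inj: "\<And>i j. c i = c j \<longleftrightarrow> k dvd (i - j)"
  shows unique_next
  unfolding unique_next_def
proof (intro allI impI, elim conjE, rule ccontr)
  fix u v a b
  assume ab: "(u, a) \<in> E" "(u, b) \<in> E" "v \<in> V" "Suc (d a v) = d u v" "Suc (d b v) = d u v" "a \<noteq> b"
  obtain j where j: "v = c j" using V ab by blast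
  \<comment> \<open>\<open>reach\<close> and \<open>near\<close> stand in for a distance formula:
    \<open>n\<close> steps shift the index by at most \<open>n\<close>, and a shift by
    \<open>t\<close> takes at most \<open>\<bar>t\<bar>\<close> steps.\<close>
  have reach: "\<exists>t. \<bar>t\<bar> \<le> int n \<and> x = c (j + t)" if "(c j, x) \<in> E ^^ n" for x n
    using that
  proof (induction n arbitrary: x)
    case 0
    then show ?case by (intro exI[of _ 0]) simp
  next
    case (Suc n)
    then obtain t where t: "\<bar>t\<bar> \<le> int n" "(c (j + t), x) \<in> E" by fastforce
    then have "x = c (j + (t + 1)) \<or> x = c (j + (t - 1))"
      using nb[of "j + t" x] by (simp add: algebra_simps)
    moreover have "\<bar>t + 1\<bar> \<le> int (Suc n)" "\<bar>t - 1\<bar> \<le> int (Suc n)" using t by auto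
    ultimately show ?case by blast
  qed
  have near: "d (c (j + t)) v \<le> nat \<bar>t\<bar>" for t
  proof -
    have walk: "(c i, c (i + int n)) \<in> E ^^ n" for i n
      by (rule relpow_int_seq) (rule edge)
    show ?thesis
    proof (cases "0 \<le> t")
      case True
      then show ?thesis using d_le[OF walk[of j "nat t"]] j d_sym[of v] by simp
    next
      case False
      then show ?thesis using d_le[OF walk[of "j + t" "nat (- t)"]] j by simp
    qed
  qed
  obtain i where i: "u = c i" using V ab E_V by blast
  have aV: "a \<in> V" "b \<in> V" "c j \<in> V" using ab j E_V by auto
  \<comment> \<open>Stated for fresh \<open>a\<close> and \<open>b\<close>, since the two neighbours
    of \<open>u\<close> may occur in either order.\<close>
  have "False" if nx: "a = c (i + 1)" "b = c (i - 1)"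
    and e: "Suc (d a v) = d u v" "Suc (d b v) = d u v" "a \<in> V" "b \<in> V" for a b
  proof -
    obtain s where s: "\<bar>s\<bar> \<le> int (d a v)" "a = c (j + s)"
      using reach[OF sym_relpow[OF sym_E d_walk]] e(3) aV(3) j by blast
    obtain t where t: "\<bar>t\<bar> \<le> int (d b v)" "b = c (j + t)"
      using reach[OF sym_relpow[OF sym_E d_walk]] e(4) aV(3) j by blast
    have div: "k dvd (j + s - (i + 1))" "k dvd (j + t - (i - 1))"
      using nx s t inj by metis+
    then have "c (j + (s - 1)) = u" "c (j + (t + 1)) = u"
      using inj i by (simp_all add: algebra_simps)
    then have "d u v \<le> nat \<bar>s - 1\<bar>" "d u v \<le> nat \<bar>t + 1\<bar>"
      using near by metis+
    \<comment> \<open>As seen from \<open>v\<close>, the vertex \<open>u\<close> has offsets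
      \<open>s - 1\<close> and \<open>t + 1\<close>. Their absolute values must exceed those of
      \<open>s\<close> and \<open>t\<close>, which fixes both signs.\<close>
    then have st: "s = - int (d a v)" "t = int (d a v)"
      using s t e by linarith+
    have "k dvd (j + t - (i - 1)) - (j + s - (i + 1))" by (rule dvd_diff[OF div(2) div(1)])
    then have "k dvd 2 * (int (d a v) + 1)" using st by simp
    moreover have "coprime k 2" using k by simp
    ultimately have "k dvd int (d a v) + 1" by (simp only: coprime_dvd_mult_right_iff)
    moreover have "k dvd j + (t + 1) - i" using div by (simp add: algebra_simps)
    then have "k dvd (j - i) + (int (d a v) + 1)" using st by (simp add: algebra_simps)
    ultimately have "k dvd j - i" using dvd_add_left_iff by blast
    then have "u = v" using inj i j by metis
    then show False using e by simp
  qed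
  then show False using nb i ab aV by metis
qed

end


section \<open>Geodesics as vertex lists\<close>

lemma connected_graph_iff:
  assumes "graph H"
  shows "connected H \<longleftrightarrow> verts H \<noteq> {} \<and> (\<forall>u\<in>verts H. \<forall>v\<in>verts H. (u, v) \<in> (arcs_ends H)\<^sup>*)"
proof -
  interpret graph H by fact
  show ?thesis
    using sym_arcs
    by (auto simp: connected_def strongly_connected_def reachable_mk_symmetric_eq reachable_conv')
qed

locale connected_graph = graph G for G :: "('a, 'b) pre_digraph" (structure) +
  assumes graph_connected: "connected G"

sublocale connected_graph \<subseteq> connected_rel "verts G" "arcs_ends G"
proof
  show "arcs_ends G \<subseteq> verts G \<times> verts G" using adj_in_verts by auto
  show "sym (arcs_ends G)" using sym_arcs by (simp add: symmetric_def)
  show "(x, x) \<notin> arcs_ends G" for x using adj_not_same by blast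
  show "(u, v) \<in> (arcs_ends G)\<^sup>*" if "u \<in> verts G" "v \<in> verts G" for u v
    using graph_connected that connected_graph_iff[OF graph_axioms] by blast
qed

context connected_graph
begin

lemma vwalk_relpow:
  assumes "vwalk p G"
  shows "(hd p, last p) \<in> arcs_ends G ^^ (length p - 1)"
  using assms
proof (induction p)
  case (Cons u v es)
  then show ?case by (auto intro: relpow_Suc_I2 simp del: relpow.simps)
qed simp

lemma relpow_vwalk:
  assumes "(u, v) \<in> arcs_ends G ^^ n" "u \<in> verts G"
  shows "\<exists>p. vwalk p G \<and> hd p = u \<and> last p = v \<and> length p = Suc n"
  using assms
proof (induction n arbitrary: u)
  case 0
  then show ?case by (intro exI[of _ "[u]"]) auto
next
  case (Suc n)
  then obtain a where a: "(u, a) \<in> arcs_ends G" "(a, v) \<in> arcs_ends G ^^ n"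
    by (meson relpow_Suc_E2)
  then obtain p where "vwalk p G" "hd p = a" "last p = v" "length p = Suc n"
    using Suc.IH E_V by blast
  with a show ?case
    by (intro exI[of _ "u # p"]) (auto intro: vwalk_wf_digraph_consI)
qed

lemma vwalk_d_le: "vwalk p G \<Longrightarrow> d (hd p) (last p) \<le> length p - 1"
  using vwalk_relpow d_le by blast

text \<open>A vertex list has one entry more than edges, so \<open>length p\<close> counts the edges
  of \<open>u # p\<close>. A shorter walk from \<open>hd p\<close> would shorten
  \<open>u # p\<close> as well.\<close>

lemma shortest_vwalk_tl:
  assumes "vwalk (u # p) G" "p \<noteq> []" "length p = d u (last p)"
  shows "vwalk p G" "(u, hd p) \<in> arcs_ends G" "length p = Suc (d (hd p) (last p))"
proof -
  show p: "vwalk p G" "(u, hd p) \<in> arcs_ends G"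
    using vwalk_consE[OF assms(1,2)] by blast+
  then have "last p \<in> verts G" using assms(2) by (metis last_in_set vwalk_verts_in_verts)
  then have "d u (last p) \<le> Suc (d (hd p) (last p))" using d_edge_le p by blast
  then show "length p = Suc (d (hd p) (last p))"
    using vwalk_d_le[OF p(1)] assms(2,3) by (cases p) auto
qed

text \<open>All later vertices are strictly closer to the end than the first one, so it cannot
  recur. The distance bound is carried along to make this induction work.\<close>

lemma shortest_vwalk_distinct:
  assumes "vwalk p G" "length p = Suc (d (hd p) (last p))"
  shows "distinct p \<and> (\<forall>x\<in>set p. d x (last p) \<le> d (hd p) (last p))"
  using assms
proof (induction p rule: list.induct)
  case (Cons u p)
  show ?case
  proof (cases "p = []")
    case False
    note tl = shortest_vwalk_tl[OF Cons.prems(1) False]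
    have len: "length p = d u (last p)" using Cons.prems(2) False by simp
    with tl have "distinct p" "\<forall>x\<in>set p. d x (last p) \<le> d (hd p) (last p)"
      "Suc (d (hd p) (last p)) = d u (last p)"
      using Cons.IH by auto
    then show ?thesis using False by (auto intro: le_SucI)
  qed simp
qed simp

text \<open>\<open>geodesic\<close> minimises over paths and \<open>d\<close> over walks; the minima
  agree because a shortest walk is a path.\<close>

lemma geodesic_iff:
  assumes "u \<in> verts G" "v \<in> verts G"
  shows "geodesic G u v p \<longleftrightarrow> vwalk p G \<and> hd p = u \<and> last p = v \<and> length p = Suc (d u v)"
proof -
  have min: "Suc (d u v) \<le> length p" if "vwalk p G" "hd p = u" "last p = v" for p
    using vwalk_d_le[OF that(1)] that by (cases p) auto
  obtain q where q: "vwalk q G" "hd q = u" "last q = v" "length q = Suc (d u v)"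
    using relpow_vwalk[OF d_walk[OF assms]] assms by blast
  then have "vpath q G" using shortest_vwalk_distinct by blast
  have "length p = Suc (d u v)" if p: "geodesic G u v p"
  proof -
    have "vwalk p G" "hd p = u" "last p = v" "length p - 1 \<le> length q - 1"
      using p q \<open>vpath q G\<close> unfolding geodesic_def vpath_def by auto
    then show ?thesis using min[of p] q(4) by simp
  qed
  moreover have "geodesic G u v p"
    if p: "vwalk p G" "hd p = u" "last p = v" "length p = Suc (d u v)"
  proof -
    have "length p - 1 \<le> length r - 1" if "vpath r G" "hd r = u" "last r = v" for r
      using min[of r] that p(4) unfolding vpath_def by simp
    moreover have "distinct p" using shortest_vwalk_distinct p by blast
    ultimately show ?thesis using p unfolding geodesic_def vpath_def by simp
  qed
  ultimately show ?thesis unfolding geodesic_def vpath_def by blast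
qed

lemma shortest_vwalk_unique:
  assumes un: unique_next
    and "vwalk p G" "length p = Suc (d u v)" "hd p = u" "last p = v"
    and "vwalk q G" "length q = Suc (d u v)" "hd q = u" "last q = v"
  shows "p = q"
  using assms(2-)
proof (induction p arbitrary: q u rule: list.induct)
  case (Cons x p)
  then obtain q' where q: "q = u # q'" and x: "x = u" by (cases q) auto
  show ?case
  proof (cases "p = []")
    case True
    then show ?thesis using Cons q by auto
  next
    case False
    then have "q' \<noteq> []" using Cons.prems q by auto
    have p': "vwalk p G" "(u, hd p) \<in> arcs_ends G" "length p = Suc (d (hd p) v)" "last p = v"
      using shortest_vwalk_tl[of u p] Cons.prems x False by auto
    have q': "vwalk q' G" "(u, hd q') \<in> arcs_ends G" "length q' = Suc (d (hd q') v)" "last q' = v"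
      using shortest_vwalk_tl[of u q'] Cons.prems q \<open>q' \<noteq> []\<close> by auto
    have "v \<in> verts G" using p' False by (metis last_in_set vwalk_verts_in_verts)
    then have hd_eq: "hd p = hd q'"
      using Cons.prems p' q' q by (intro unique_nextD[OF un p'(2) q'(2)]) auto
    have "length q' = Suc (d (hd p) v)" using q'(3) unfolding hd_eq .
    then have "p = q'"
      using Cons.IH[OF p'(1,3) refl p'(4) q'(1) _ hd_eq[symmetric] q'(4)] by blast
    then show ?thesis by (simp only: x q)
  qed
qed simp

text \<open>Each next vertex starts a geodesic of its own; conversely, unique next vertices
  determine a geodesic entry by entry.\<close>

theorem geodetic_iff_unique_next: "geodetic G \<longleftrightarrow> unique_next"
proof
  assume geo: "geodetic G"
  show unique_next
    unfolding unique_next_def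
  proof (intro allI impI, elim conjE)
    fix u v a b
    assume ab: "(u, a) \<in> arcs_ends G" "(u, b) \<in> arcs_ends G" "v \<in> verts G"
      "Suc (d a v) = d u v" "Suc (d b v) = d u v"
    have u: "u \<in> verts G" using ab E_V by blast
    have ex: "\<exists>p. geodesic G u v (u # p) \<and> hd p = a"
      if "(u, a) \<in> arcs_ends G" "Suc (d a v) = d u v" for a
    proof -
      have "a \<in> verts G" using that E_V by blast
      then obtain p where p: "vwalk p G" "hd p = a" "last p = v" "length p = Suc (d a v)"
        using relpow_vwalk[OF d_walk] ab by blast
      then have "vwalk (u # p) G" using vwalk_wf_digraph_consI that by blast
      with p that show ?thesis using geodesic_iff[OF u ab(3), of "u # p"] by force
    qed
    obtain p q where "geodesic G u v (u # p)" "hd p = a" "geodesic G u v (u # q)" "hd q = b"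
      using ex ab by meson
    moreover from this have "u # p = u # q"
      using geo u ab(3) unfolding geodetic_def by blast
    ultimately show "a = b" by simp
  qed
next
  assume un: unique_next
  show "geodetic G"
    unfolding geodetic_def
  proof (intro ballI ex_ex1I)
    fix u v assume uv: "u \<in> verts G" "v \<in> verts G"
    show "\<exists>p. geodesic G u v p"
      using relpow_vwalk[OF d_walk[OF uv]] uv geodesic_iff by blast
    show "p = q" if "geodesic G u v p" "geodesic G u v q" for p q
      using shortest_vwalk_unique[OF un, of p u v q] that geodesic_iff[OF uv] by blast
  qed
qed

end

section \<open>Inseparable subgraphs and blocks\<close>

lemma (in graph) graph_subgraph:
  assumes "subgraph H G" "sym (arcs_ends H)"
  shows "graph H"
proof -
  interpret H: digraph H using assms(1) by (rule digraph_subgraph)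
  show ?thesis using assms(2) by (intro H.graphI) (simp add: symmetric_def)
qed

lemma arcs_ends_induce_subgraph: "arcs_ends (G \<restriction> S) = Restr (arcs_ends G) S"
  by (auto simp: arcs_ends_conv)

lemma arcs_ends_del_vert: "arcs_ends (pre_digraph.del_vert G x) = Restr (arcs_ends G) (- {x})"
  by (auto simp: arcs_ends_conv pre_digraph.del_vert_simps)

lemma (in graph) sym_arcs_ends: "sym (arcs_ends G)"
  using sym_arcs by (simp add: symmetric_def)

lemma sym_Restr: "sym R \<Longrightarrow> sym (Restr R S)"
  by (auto simp: sym_def)

lemma (in graph) graph_induce_subgraph:
  "S \<subseteq> verts G \<Longrightarrow> graph (G \<restriction> S)"
  using sym_arcs_ends
  by (intro graph_subgraph) (auto simp: arcs_ends_induce_subgraph intro: sym_Restr induced_imp_subgraph)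

lemma (in graph) graph_del_vert: "graph (del_vert x)"
  using sym_arcs_ends
  by (intro graph_subgraph subgraph_del_vert) (auto simp: arcs_ends_del_vert intro: sym_Restr)

lemma (in graph) no_cut_vertex_walk:
  assumes "\<nexists>x. cut_vertex G x" "x \<in> verts G" "u \<in> verts G - {x}" "v \<in> verts G - {x}"
  shows "(u, v) \<in> (Restr (arcs_ends G) (- {x}))\<^sup>*"
proof -
  have "connected (del_vert x)" using assms by (auto simp: cut_vertex_def pre_digraph.del_vert_simps)
  then show ?thesis
    using assms connected_graph_iff[OF graph_del_vert[of x]]
    by (auto simp: arcs_ends_del_vert pre_digraph.del_vert_simps)
qed

text \<open>The property that blocks maximise; single vertices and single edges have it.\<close>

definition inseparable :: "('a, 'b) pre_digraph \<Rightarrow> bool" where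
  "inseparable H \<longleftrightarrow> graph H \<and> connected H \<and> (\<nexists>x. cut_vertex H x)"

lemma block_iff: "block G B \<longleftrightarrow> subgraph B G \<and> inseparable B \<and>
    (\<forall>H. H \<noteq> B \<and> subgraph B H \<and> subgraph H G \<longrightarrow> \<not> inseparable H)"
  unfolding block_def pre_digraph.max_subgraph_def inseparable_def by blast

lemma rtrancl_via_root:
  assumes "sym R" "(r, a) \<in> R\<^sup>*" "(r, b) \<in> R\<^sup>*"
  shows "(a, b) \<in> R\<^sup>*"
  using assms by (meson rtrancl_trans sym_rtrancl symD)

text \<open>By symmetry, connectivity reduces to reachability from one root, which may be chosen
  anew for each deleted vertex.\<close>

lemma (in graph) inseparable_induce_subgraph:
  assumes S: "S \<subseteq> verts G" "S \<noteq> {}"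
    and root: "\<exists>r. \<forall>a\<in>S. (r, a) \<in> (Restr (arcs_ends G) S)\<^sup>*"
    and del: "\<And>x. x \<in> S \<Longrightarrow> \<exists>r. \<forall>a\<in>S - {x}. (r, a) \<in> (Restr (arcs_ends G) (S - {x}))\<^sup>*"
  shows "inseparable (G \<restriction> S)"
proof -
  have gr: "graph (G \<restriction> S)" using S by (intro graph_induce_subgraph)
  have "connected (G \<restriction> S)"
    using S root unfolding connected_graph_iff[OF gr]
    by (auto simp: arcs_ends_induce_subgraph intro: rtrancl_via_root[OF sym_Restr[OF sym_arcs_ends]])
  moreover have "\<not> cut_vertex (G \<restriction> S) x" for x
  proof
    assume x: "cut_vertex (G \<restriction> S) x"
    have "Restr (Restr (arcs_ends G) S) (- {x}) = Restr (arcs_ends G) (S - {x})" by auto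
    moreover have "x \<in> S" using x by (simp add: cut_vertex_def)
    then obtain r where "\<forall>a\<in>S - {x}. (r, a) \<in> (Restr (arcs_ends G) (S - {x}))\<^sup>*" using del by blast
    moreover from this have "\<forall>a\<in>S - {x}. \<forall>b\<in>S - {x}. (a, b) \<in> (Restr (arcs_ends G) (S - {x}))\<^sup>*"
      using rtrancl_via_root[OF sym_Restr[OF sym_arcs_ends]] by blast
    ultimately have "\<forall>a\<in>S - {x}. \<forall>b\<in>S - {x}. (a, b) \<in> (arcs_ends (pre_digraph.del_vert (G \<restriction> S) x))\<^sup>*"
      by (simp add: arcs_ends_del_vert arcs_ends_induce_subgraph)
    then show False
      using x connected_graph_iff[OF graph.graph_del_vert[OF gr, of x]]
      by (simp add: cut_vertex_def pre_digraph.del_vert_simps)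
  qed
  ultimately show ?thesis using gr by (simp add: inseparable_def)
qed

text \<open>By finiteness some inseparable subgraph containing \<open>H\<close> has the largest
  number of vertices and arcs together; it is maximal.\<close>

lemma (in graph) subgraph_in_block:
  assumes "subgraph H G" "inseparable H"
  shows "\<exists>B. block G B \<and> subgraph H B"
proof -
  define P where "P K \<longleftrightarrow> subgraph H K \<and> subgraph K G \<and> inseparable K" for K
  define size where "size K = card (verts K) + card (arcs K)" for K :: "('a, 'b) pre_digraph"
  have "P H" using assms by (auto simp: P_def intro: wf_digraph.subgraph_refl)
  moreover have "\<forall>K. P K \<longrightarrow> size K < Suc (card (verts G) + card (arcs G))"
    by (auto simp: P_def size_def less_Suc_eq_le intro!: add_mono card_mono)
  ultimately obtain B where B: "P B" and max: "\<And>K. P K \<Longrightarrow> size K \<le> size B"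
    using ex_has_greatest_nat[of P H size] by blast
  have "\<not> inseparable K" if K: "K \<noteq> B" "subgraph B K" "subgraph K G" for K
  proof
    assume "inseparable K"
    then have "size K \<le> size B"
      using max[of K] K B subgraph_trans[of H B K] by (simp add: P_def)
    moreover have fin: "finite (verts K)" "finite (arcs K)"
      using K finite_verts finite_arcs by (auto elim!: subgraphE intro: finite_subset)
    moreover have sub: "verts B \<subseteq> verts K" "arcs B \<subseteq> arcs K" using K by auto
    moreover have "card (verts B) \<le> card (verts K)" "card (arcs B) \<le> card (arcs K)"
      using fin sub by (auto intro: card_mono)
    ultimately have "card (verts K) \<le> card (verts B)" "card (arcs K) \<le> card (arcs B)"
      unfolding size_def by linarith+
    then have "verts B = verts K" "arcs B = arcs K"
      using card_seteq[OF fin(1) sub(1)] card_seteq[OF fin(2) sub(2)] by blast+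
    \<comment> \<open>Compatible digraphs share \<open>tail\<close> and \<open>head\<close>, so
      equal vertex and arc sets make the records equal.\<close>
    moreover have "compatible K B" using K by auto
    ultimately have "K = B" by (intro pre_digraph.equality) (auto simp: compatible_def)
    with K show False by simp
  qed
  with B show ?thesis by (auto simp: P_def block_iff)
qed

lemma shortest_walk_inj:
  assumes "(u, w) \<in> R\<^sup>*"
  obtains f and n :: nat where "f 0 = u" "f n = w" "\<And>i. i < n \<Longrightarrow> (f i, f (Suc i)) \<in> R"
    "\<And>i j. i < j \<Longrightarrow> j \<le> n \<Longrightarrow> f i \<noteq> f j"
proof -
  define n where "n = (LEAST n. (u, w) \<in> R ^^ n)"
  have "\<exists>n. (u, w) \<in> R ^^ n" using assms by (simp add: rtrancl_power)
  then have "(u, w) \<in> R ^^ n" unfolding n_def by (rule LeastI_ex)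
  then obtain f where f: "f 0 = u" "f n = w" "\<And>i. i < n \<Longrightarrow> (f i, f (Suc i)) \<in> R"
    unfolding relpow_fun_conv by blast
  moreover have "f i \<noteq> f j" if ij: "i < j" "j \<le> n" for i j
  proof
    assume "f i = f j"
    have "(f 0, f i) \<in> R ^^ (i - 0)" "(f j, f n) \<in> R ^^ (n - j)"
      using f ij by (intro relpow_nat_seq; simp)+
    then have "(u, w) \<in> R ^^ (i + (n - j))"
      using relpow_trans f \<open>f i = f j\<close> by fastforce
    then have "n \<le> i + (n - j)" unfolding n_def by (rule Least_le)
    with ij show False by simp
  qed
  ultimately show ?thesis by (rule that)
qed

section \<open>Cliques and complete blocks\<close>

context connected_graph
begin

definition clique :: "'a set \<Rightarrow> bool" where
  "clique S \<longleftrightarrow> S \<subseteq> verts G \<and> (\<forall>u\<in>S. \<forall>v\<in>S. u \<noteq> v \<longrightarrow> (u, v) \<in> arcs_ends G)"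

lemma cliqueD: "clique S \<Longrightarrow> u \<in> S \<Longrightarrow> v \<in> S \<Longrightarrow> u \<noteq> v \<Longrightarrow> (u, v) \<in> arcs_ends G"
  by (simp add: clique_def)

lemma clique_inseparable:
  assumes "clique S" "S \<noteq> {}"
  shows "inseparable (G \<restriction> S)"
proof (rule inseparable_induce_subgraph)
  have root: "\<exists>r. \<forall>a\<in>T. (r, a) \<in> (Restr (arcs_ends G) T)\<^sup>*" if "T \<subseteq> S" for T
  proof (cases "T = {}")
    case False
    then obtain r where "r \<in> T" by blast
    have "(r, a) \<in> (Restr (arcs_ends G) T)\<^sup>*" if "a \<in> T" for a
    proof (cases "a = r")
      case False
      then show ?thesis
        using assms(1) \<open>T \<subseteq> S\<close> \<open>r \<in> T\<close> that by (intro r_into_rtrancl) (auto intro: cliqueD)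
    qed simp
    then show ?thesis by blast
  qed simp
  show "\<exists>r. \<forall>a\<in>S. (r, a) \<in> (Restr (arcs_ends G) S)\<^sup>*"
    "\<exists>r. \<forall>a\<in>S - {x}. (r, a) \<in> (Restr (arcs_ends G) (S - {x}))\<^sup>*" for x
    by (intro root; blast)+
qed (use assms in \<open>auto simp: clique_def\<close>)

lemma clique_in_block:
  assumes "clique S" "S \<noteq> {}"
  shows "\<exists>B. block G B \<and> S \<subseteq> verts B"
proof -
  have "subgraph (G \<restriction> S) G"
    using assms by (auto simp: clique_def intro: induced_imp_subgraph)
  then obtain B where B: "block G B" "subgraph (G \<restriction> S) B"
    using subgraph_in_block clique_inseparable assms by blast
  from subgraph_imp_subverts[OF B(2)] have "S \<subseteq> verts B" by simp
  with B show ?thesis by blast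
qed

lemma blockD:
  assumes "block G B"
  shows "subgraph B G" "verts B \<subseteq> verts G" "arcs_ends B \<subseteq> arcs_ends G" "inseparable B" "verts B \<noteq> {}"
proof -
  show B: "subgraph B G" "inseparable B" using assms by (auto simp: block_iff)
  then show "verts B \<subseteq> verts G" "arcs_ends B \<subseteq> arcs_ends G" by (auto dest: arcs_ends_mono)
  show "verts B \<noteq> {}" using B connected_graph_iff by (auto simp: inseparable_def)
qed

text \<open>A clique induces an inseparable subgraph, which cannot properly extend a block. With
  \<open>S = verts B\<close> this shows that a block on a clique is an induced subgraph.\<close>

lemma block_maximal_clique:
  assumes B: "block G B" and S: "clique S" "verts B \<subseteq> S"
  shows "G \<restriction> S = B"
proof -
  note B' = blockD[OF B]
  have "subgraph (G \<restriction> S) G"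
    using S by (auto simp: clique_def intro: induced_imp_subgraph)
  moreover have "subgraph B (G \<restriction> S)"
    using B'(1) S by (intro subgraphI) (auto simp: compatible_def subgraph_def wf_digraph.wellformed)
  moreover have "inseparable (G \<restriction> S)"
    using S B' by (intro clique_inseparable) auto
  ultimately show ?thesis using B unfolding block_iff by blast
qed

text \<open>Adjacency to \<open>u\<close> spreads along walks in \<open>B\<close>: if
  \<open>v\<close> is adjacent to \<open>u\<close> and to \<open>w\<close>, then \<open>u\<close>
  and \<open>w\<close> are joined in \<open>B\<close> without \<open>v\<close>, which is no cut
  vertex, so \<open>clique_blocks\<close> applies at \<open>v\<close>.\<close>

lemma clique_blocks_clique:
  assumes cb: clique_blocks and B: "block G B"
  shows "clique (verts B)"
  unfolding clique_def
proof (intro conjI ballI impI)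
  note B' = blockD[OF B]
  then show "verts B \<subseteq> verts G" by blast
  interpret B: graph B using B' by (simp add: inseparable_def)
  have B_nocut: "\<nexists>x. cut_vertex B x" using B' by (simp add: inseparable_def)
  fix u w assume uw: "u \<in> verts B" "w \<in> verts B" "u \<noteq> w"
  have "(u, w) \<in> (arcs_ends B)\<^sup>*"
    using B' uw connected_graph_iff[OF B.graph_axioms] by (simp add: inseparable_def)
  then have "u = w \<or> (u, w) \<in> arcs_ends G"
  proof induction
    case (step v w)
    then have vw: "(v, w) \<in> arcs_ends B" "v \<in> verts B" "w \<in> verts B"
      using B.adj_in_verts by auto
    show ?case
    proof (cases "u = v \<or> u = w")
      case True
      then show ?thesis using vw B' by blast
    next
      case False
      moreover have "v \<noteq> w" using vw B.adj_not_same by blast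
      ultimately have "(u, w) \<in> (Restr (arcs_ends B) (- {v}))\<^sup>*"
        using uw vw by (intro B.no_cut_vertex_walk[OF B_nocut]) auto
      moreover have "Restr (arcs_ends B) (- {v}) \<subseteq> avoiding v" using B' by blast
      ultimately have "(u, w) \<in> (avoiding v)\<^sup>*" using rtrancl_mono by blast
      moreover have "(v, u) \<in> arcs_ends G" "(v, w) \<in> arcs_ends G"
        using False step.IH E_sym vw B' by blast+
      ultimately show ?thesis using clique_blocksD[OF cb] by blast
    qed
  qed simp
  with uw show "(u, w) \<in> arcs_ends G" by simp
qed

lemma block_complete_iff:
  assumes B: "block G B"
  shows "(\<exists>n. complete_digraph n B) \<longleftrightarrow> clique (verts B)"
proof
  assume "\<exists>n. complete_digraph n B"
  then show "clique (verts B)"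
    using blockD[OF B] by (auto simp: complete_digraph_def clique_def)
next
  assume cl: "clique (verts B)"
  have "arcs_ends B = Restr (arcs_ends G) (verts B)"
    using arcs_ends_induce_subgraph[of G "verts B"] block_maximal_clique[OF B cl order_refl] by simp
  then have "arcs_ends B = {(u, v). (u, v) \<in> verts B \<times> verts B \<and> u \<noteq> v}"
    using cl irrefl_E by (auto simp: clique_def)
  then show "\<exists>n. complete_digraph n B"
    using blockD[OF B] by (simp add: complete_digraph_def inseparable_def)
qed

text \<open>From left to right, \<open>v\<close> closes a shortest walk from \<open>u\<close> to
  \<open>w\<close> to a cycle. A cycle is inseparable, hence lies in a block, and this block is
  complete.\<close>

lemma complete_blocks_iff: "(\<forall>B. block G B \<longrightarrow> (\<exists>n. complete_digraph n B)) \<longleftrightarrow> clique_blocks"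
proof
  assume "clique_blocks"
  then show "\<forall>B. block G B \<longrightarrow> (\<exists>n. complete_digraph n B)"
    using clique_blocks_clique block_complete_iff by blast
next
  assume complete: "\<forall>B. block G B \<longrightarrow> (\<exists>n. complete_digraph n B)"
  show clique_blocks
    unfolding clique_blocks_def
  proof (intro allI impI, elim conjE)
    fix v u w
    assume v: "(v, u) \<in> arcs_ends G" "(v, w) \<in> arcs_ends G" and uw: "(u, w) \<in> (avoiding v)\<^sup>*"
    show "u = w \<or> (u, w) \<in> arcs_ends G"
    proof (unfold disj_imp, rule impI)
      assume "u \<noteq> w"
      obtain f and n :: nat where f: "f 0 = u" "f n = w"
        and fE: "\<And>i. i < n \<Longrightarrow> (f i, f (Suc i)) \<in> avoiding v"
        and finj: "\<And>i j. i < j \<Longrightarrow> j \<le> n \<Longrightarrow> f i \<noteq> f j"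
        using shortest_walk_inj[OF uw] by metis
      have "n \<noteq> 0" using f \<open>u \<noteq> w\<close> by (intro notI) simp
      have fv: "f i \<noteq> v" if "i \<le> n" for i
        using that fE[of i] fE[of "i - 1"] \<open>n \<noteq> 0\<close> by (cases "i < n") auto
      define S where "S = insert v (f ` {..n})"
      have fS: "f i \<in> S" if "i \<le> n" for i using that by (auto simp: S_def)
      have fV: "f i \<in> verts G" if "i \<le> n" for i
        using that fE[of i] fE[of "i - 1"] \<open>n \<noteq> 0\<close> E_V by (cases "i < n") auto
      have path: "(f i, f j) \<in> (Restr (arcs_ends G) T)\<^sup>*"
        if "i \<le> j" "j \<le> n" "\<And>l. i \<le> l \<Longrightarrow> l \<le> j \<Longrightarrow> f l \<in> T" for i j T
      proof -
        have "(f i, f j) \<in> Restr (arcs_ends G) T ^^ (j - i)"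
          using that fE by (intro relpow_nat_seq) auto
        then show ?thesis by (rule relpow_imp_rtrancl)
      qed
      have "inseparable (G \<restriction> S)"
      proof (rule inseparable_induce_subgraph)
        show "S \<subseteq> verts G" "S \<noteq> {}" using v E_V fV by (auto simp: S_def)
        have "(v, f i) \<in> (Restr (arcs_ends G) S)\<^sup>*" if "i \<le> n" for i
        proof -
          have "(v, f 0) \<in> Restr (arcs_ends G) S" using v f fS[of 0] by (auto simp: S_def)
          moreover have "(f 0, f i) \<in> (Restr (arcs_ends G) S)\<^sup>*"
            using that fS by (intro path) simp_all
          ultimately show ?thesis by (rule converse_rtrancl_into_rtrancl)
        qed
        then show "\<exists>r. \<forall>a\<in>S. (r, a) \<in> (Restr (arcs_ends G) S)\<^sup>*"
          by (intro exI[of _ v]) (auto simp: S_def)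
        show "\<exists>r. \<forall>a\<in>S - {x}. (r, a) \<in> (Restr (arcs_ends G) (S - {x}))\<^sup>*" if x: "x \<in> S" for x
        proof (cases "x = v")
          case True
          have "(f 0, f i) \<in> (Restr (arcs_ends G) (S - {x}))\<^sup>*" if "i \<le> n" for i
            using that fS fv True by (intro path) simp_all
          then show ?thesis using True by (intro exI[of _ "f 0"]) (auto simp: S_def)
        next
          case False
          \<comment> \<open>Removing \<open>f k\<close> splits the path into two pieces, but
            \<open>v\<close> still reaches the first through \<open>f 0\<close> and the second
            through \<open>f n\<close>.\<close>
          then obtain k where k: "k \<le> n" "x = f k" using x by (auto simp: S_def)
          let ?R = "Restr (arcs_ends G) (S - {x})"
          have "(v, f i) \<in> ?R\<^sup>*" if i: "i \<le> n" "i \<noteq> k" for i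
          proof (cases "i < k")
            case True
            have notx: "f j \<noteq> x" if "j \<le> i" for j using finj[of j k] k that True by auto
            have "(v, f 0) \<in> ?R"
              using v f fS[of 0] notx[of 0] False by (auto simp: S_def)
            moreover have "(f 0, f i) \<in> ?R\<^sup>*"
              using i fS notx by (intro path) simp_all
            ultimately show ?thesis by (rule converse_rtrancl_into_rtrancl)
          next
            case ki: False
            have notx: "f j \<noteq> x" if "i \<le> j" "j \<le> n" for j using finj[of k j] k that ki i by auto
            have "(v, f n) \<in> ?R"
              using v f fS[of n] notx[of n] i False by (auto simp: S_def)
            moreover have "(f i, f n) \<in> ?R\<^sup>*"
              using i fS notx by (intro path) simp_all
            then have "(f n, f i) \<in> ?R\<^sup>*"
              by (rule symD[OF sym_rtrancl[OF sym_Restr[OF sym_arcs_ends]]])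
            ultimately show ?thesis by (rule converse_rtrancl_into_rtrancl)
          qed
          then show ?thesis using k by (intro exI[of _ v]) (auto simp: S_def)
        qed
      qed
      moreover have "subgraph (G \<restriction> S) G"
        using v E_V fV by (auto simp: S_def intro!: induced_imp_subgraph induced_induce)
      ultimately obtain B where B: "block G B" "subgraph (G \<restriction> S) B"
        using subgraph_in_block by blast
      have "clique (verts B)" using complete B block_complete_iff by blast
      moreover have "S \<subseteq> verts B" using subgraph_imp_subverts[OF B(2)] by simp
      then have "u \<in> verts B" "w \<in> verts B" using fS[of 0] fS[of n] f by auto
      ultimately show "(u, w) \<in> arcs_ends G" using \<open>u \<noteq> w\<close> cliqueD by blast
    qed
  qed
qed

section \<open>Claws and blocks through a vertex\<close>

lemma claw_free_iff:
  "claw_free \<longleftrightarrow> \<not> (\<exists>H. induced_subgraph H G \<and> complete_bipartite_digraph 1 3 H)"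
proof
  assume cf: claw_free
  show "\<not> (\<exists>H. induced_subgraph H G \<and> complete_bipartite_digraph 1 3 H)"
  proof
    assume "\<exists>H. induced_subgraph H G \<and> complete_bipartite_digraph 1 3 H"
    then obtain H U W where H: "induced_subgraph H G" and UW: "verts H = U \<union> W" "U \<inter> W = {}"
      "card U = 1" "card W = 3" "arcs_ends H = U \<times> W \<union> W \<times> U"
      by (auto simp: complete_bipartite_digraph_def)
    obtain x where x: "U = {x}" using UW by (auto simp: card_1_singleton_iff)
    obtain a b c where abc: "W = {a, b, c}" "a \<noteq> b" "a \<noteq> c" "b \<noteq> c"
      using UW by (auto simp: card_3_iff)
    have "H = G \<restriction> verts H"
      using H by (intro pre_digraph.equality) (auto simp: induced_subgraph_def subgraph_def compatible_def)
    then have ends: "Restr (arcs_ends G) (verts H) = U \<times> W \<union> W \<times> U"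
      using arcs_ends_induce_subgraph[of G "verts H"] UW by simp
    then have "(x, a) \<in> arcs_ends G" "(x, b) \<in> arcs_ends G" "(x, c) \<in> arcs_ends G"
      using x abc by auto
    moreover have "(p, q) \<notin> arcs_ends G" if "p \<in> W" "q \<in> W" for p q
    proof
      assume "(p, q) \<in> arcs_ends G"
      then have "(p, q) \<in> U \<times> W \<union> W \<times> U" using that UW(1) unfolding ends[symmetric] by blast
      then show False using that UW(2) by blast
    qed
    then have "(a, b) \<notin> arcs_ends G" "(a, c) \<notin> arcs_ends G" "(b, c) \<notin> arcs_ends G"
      using abc(1) by blast+
    ultimately show False using claw_freeD[OF cf] abc by blast
  qed
next
  assume no: "\<not> (\<exists>H. induced_subgraph H G \<and> complete_bipartite_digraph 1 3 H)"
  show claw_free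
    unfolding claw_free_def
  proof (intro allI impI, elim conjE, rule ccontr)
    fix x a b c
    assume x: "(x, a) \<in> arcs_ends G" "(x, b) \<in> arcs_ends G" "(x, c) \<in> arcs_ends G"
      and n: "\<not> (a = b \<or> a = c \<or> b = c \<or> (a, b) \<in> arcs_ends G \<or> (a, c) \<in> arcs_ends G \<or> (b, c) \<in> arcs_ends G)"
    let ?H = "G \<restriction> {x, a, b, c}"
    have V: "{x, a, b, c} \<subseteq> verts G" using x E_V by auto
    have "x \<notin> {a, b, c}" using x irrefl_E by auto
    moreover have "arcs_ends ?H = {x} \<times> {a, b, c} \<union> {a, b, c} \<times> {x}"
      using x n x[THEN E_sym] E_sym[of b a] E_sym[of c a] E_sym[of c b] irrefl_E
      unfolding arcs_ends_induce_subgraph by blast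
    moreover have "card {a, b, c} = 3" using n by auto
    ultimately have "verts ?H = {x} \<union> {a, b, c} \<and> {x} \<inter> {a, b, c} = {} \<and> card {x} = 1 \<and>
        card {a, b, c} = 3 \<and> arcs_ends ?H = {x} \<times> {a, b, c} \<union> {a, b, c} \<times> {x}"
      by simp blast
    then have "complete_bipartite_digraph 1 3 ?H"
      unfolding complete_bipartite_digraph_def
      by (intro conjI[OF graph_induce_subgraph[OF V]] exI)
    then show False using no induced_induce[OF V] by blast
  qed
qed

lemma clique_blocks_diamond:
  assumes cb: clique_blocks
    and "(x, a) \<in> arcs_ends G" "(x, b) \<in> arcs_ends G" "(a, y) \<in> arcs_ends G" "(y, b) \<in> arcs_ends G" "y \<noteq> x"
  shows "a = b \<or> (a, b) \<in> arcs_ends G"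
proof -
  have "(a, y) \<in> avoiding x" "(y, b) \<in> avoiding x" using assms irrefl_E by auto
  then have "(a, b) \<in> (avoiding x)\<^sup>*" by (rule rtrancl_trans[OF r_into_rtrancl r_into_rtrancl])
  then show ?thesis using clique_blocksD[OF cb] assms by blast
qed

text \<open>Vertices \<open>a\<close> of \<open>B\<close> and \<open>b\<close> of \<open>C\<close>
  outside \<open>{x, y}\<close> form a diamond with \<open>x\<close> and \<open>y\<close>, so the
  union of both blocks is a clique and equals each of them by maximality.\<close>

lemma blocks_eqI:
  assumes cb: clique_blocks and B: "block G B" "block G C"
    and xy: "x \<in> verts B" "y \<in> verts B" "x \<in> verts C" "y \<in> verts C" "x \<noteq> y"
  shows "B = C"
proof -
  note cl = clique_blocks_clique[OF cb B(1)] clique_blocks_clique[OF cb B(2)]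
  have adj: "(a, b) \<in> arcs_ends G" if ab: "a \<in> verts B" "b \<in> verts C" "a \<noteq> b" for a b
  proof (cases "a \<in> {x, y} \<or> b \<in> {x, y}")
    case True
    then show ?thesis using cl ab xy cliqueD by blast
  next
    case False
    then have "(x, a) \<in> arcs_ends G" "(x, b) \<in> arcs_ends G" "(a, y) \<in> arcs_ends G" "(y, b) \<in> arcs_ends G"
      using cl ab xy cliqueD by auto
    with ab xy show ?thesis using clique_blocks_diamond[OF cb] by blast
  qed
  have "(a, b) \<in> arcs_ends G" if "a \<in> verts B \<union> verts C" "b \<in> verts B \<union> verts C" "a \<noteq> b" for a b
    using that cliqueD[OF cl(1)] cliqueD[OF cl(2)] adj[of a b] adj[of b a] E_sym[of b a] by blast
  then have "clique (verts B \<union> verts C)" using cl by (simp add: clique_def)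
  then show ?thesis
    using block_maximal_clique[OF B(1) _ Un_upper1] block_maximal_clique[OF B(2) _ Un_upper2]
    by metis
qed

text \<open>Three blocks through \<open>x\<close> contribute one leaf each to a claw at
  \<open>x\<close>. Conversely, the edges of a claw lie in three different blocks, as blocks are
  cliques.\<close>

lemma clique_blocks_claw_free_iff:
  assumes cb: clique_blocks
  shows "claw_free \<longleftrightarrow> (\<forall>x\<in>verts G. card {B. block G B \<and> x \<in> verts B} \<le> 2)"
proof
  assume cf: claw_free
  show "\<forall>x\<in>verts G. card {B. block G B \<and> x \<in> verts B} \<le> 2"
  proof (rule ballI, rule ccontr)
    fix x assume "x \<in> verts G" and "\<not> card {B. block G B \<and> x \<in> verts B} \<le> 2"
    then have "3 \<le> card {B. block G B \<and> x \<in> verts B}" by simp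
    then obtain T where T: "T \<subseteq> {B. block G B \<and> x \<in> verts B}" "card T = 3"
      by (rule obtain_subset_with_card_n)
    from T(2) obtain B C D where "T = {B, C, D}" and neq: "B \<noteq> C" "B \<noteq> D" "C \<noteq> D"
      unfolding card_3_iff by blast
    then have blocks: "block G B" "block G C" "block G D" "x \<in> verts B" "x \<in> verts C" "x \<in> verts D"
      using T(1) by simp_all
    \<comment> \<open>A block consisting of \<open>x\<close> alone would lie inside the clique
      \<open>verts C\<close> and hence equal \<open>C\<close>.\<close>
    have other: "\<exists>y\<in>verts B. y \<noteq> x"
      if "block G B" "block G C" "B \<noteq> C" "x \<in> verts B" "x \<in> verts C" for B C
    proof (rule ccontr)
      assume "\<not> ?thesis"
      then have "verts B \<subseteq> verts C" using \<open>x \<in> verts C\<close> by auto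
      then show False
        using block_maximal_clique clique_blocks_clique[OF cb] that by (metis order_refl)
    qed
    \<comment> \<open>An edge from \<open>y\<close> to \<open>z\<close> would, through diamonds,
      join \<open>z\<close> to all of \<open>B\<close> and so enlarge the clique
      \<open>verts B\<close>.\<close>
    have nonadj: "y \<noteq> z \<and> (y, z) \<notin> arcs_ends G"
      if "block G B" "block G C" "B \<noteq> C" "x \<in> verts B" "x \<in> verts C"
        and y: "y \<in> verts B" "y \<noteq> x" and z: "z \<in> verts C" "z \<noteq> x" for B C y z
    proof -
      note cl = clique_blocks_clique[OF cb \<open>block G B\<close>] clique_blocks_clique[OF cb \<open>block G C\<close>]
      have zB: "z \<notin> verts B" using blocks_eqI[OF cb] that by blast
      have "(y, z) \<notin> arcs_ends G"
      proof
        assume yz: "(y, z) \<in> arcs_ends G"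
        have "(a, z) \<in> arcs_ends G" if a: "a \<in> verts B" for a
        proof (cases "a = x \<or> a = y")
          case True
          then show ?thesis using yz cl \<open>x \<in> verts C\<close> z cliqueD by blast
        next
          case False
          then have "(x, a) \<in> arcs_ends G" "(x, z) \<in> arcs_ends G" "(a, y) \<in> arcs_ends G"
            using cl a y z \<open>x \<in> verts B\<close> \<open>x \<in> verts C\<close> cliqueD by auto
          then show ?thesis using clique_blocks_diamond[OF cb _ _ _ yz] zB a y by blast
        qed
        then have "clique (insert z (verts B))"
          using cl z E_sym unfolding clique_def by blast
        then have "G \<restriction> insert z (verts B) = B"
          using block_maximal_clique[OF \<open>block G B\<close>] by blast
        then have "insert z (verts B) = verts B" by (metis induce_subgraph_verts)
        with zB show False by blast
      qed
      with zB y show ?thesis by blast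
    qed
    obtain p where p: "p \<in> verts B" "p \<noteq> x" using other blocks neq by metis
    obtain q where q: "q \<in> verts C" "q \<noteq> x" using other blocks neq by metis
    obtain r where r: "r \<in> verts D" "r \<noteq> x" using other blocks neq by metis
    have "(x, p) \<in> arcs_ends G" "(x, q) \<in> arcs_ends G" "(x, r) \<in> arcs_ends G"
      using clique_blocks_clique[OF cb] blocks p q r cliqueD by metis+
    then show False
      using claw_freeD[OF cf, of x p q r] nonadj[of B C p q] nonadj[of B D p r] nonadj[of C D q r]
        blocks neq p q r by blast
  qed
next
  assume two: "\<forall>x\<in>verts G. card {B. block G B \<and> x \<in> verts B} \<le> 2"
  show claw_free
    unfolding claw_free_def
  proof (intro allI impI, elim conjE, rule ccontr)
    fix x a b c
    assume x: "(x, a) \<in> arcs_ends G" "(x, b) \<in> arcs_ends G" "(x, c) \<in> arcs_ends G"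
      and n: "\<not> (a = b \<or> a = c \<or> b = c \<or> (a, b) \<in> arcs_ends G \<or> (a, c) \<in> arcs_ends G \<or> (b, c) \<in> arcs_ends G)"
    have edge: "\<exists>B. block G B \<and> {x, a} \<subseteq> verts B" if "(x, a) \<in> arcs_ends G" for a
      using that E_V E_sym by (intro clique_in_block) (auto simp: clique_def)
    obtain B where B: "block G B" "x \<in> verts B" "a \<in> verts B" using edge x by blast
    obtain C where C: "block G C" "x \<in> verts C" "b \<in> verts C" using edge x by blast
    obtain D where D: "block G D" "x \<in> verts D" "c \<in> verts D" using edge x by blast
    have "B \<noteq> C" "B \<noteq> D" "C \<noteq> D"
      using clique_blocks_clique[OF cb] B C D n cliqueD by metis+
    then have "card {B, C, D} = 3" by simp
    \<comment> \<open>An infinite family would have \<open>card\<close> equal to 0, and three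
      members would contradict nothing.\<close>
    moreover have "finite {B. block G B \<and> x \<in> verts B}"
      using finite_blocks by (rule rev_finite_subset) blast
    then have "card {B, C, D} \<le> card {B. block G B \<and> x \<in> verts B}"
      using B C D by (intro card_mono) auto
    moreover have "x \<in> verts G" using x E_V by blast
    ultimately show False using two by fastforce
  qed
qed

section \<open>Odd cycles\<close>

text \<open>Edges are pairs at distance 1, and \<open>min s (k - s) = 1\<close> leaves only
  cyclically consecutive indices.\<close>

lemma isometric_cycle_graph:
  assumes c: "isometric_cycle c k" and V: "range c = verts G"
  shows "cycle_graph k G"
  unfolding cycle_graph_def
proof (intro conjI exI)
  note k = isometric_cycleD(1)[OF c] and cE = isometric_cycleD(2)[OF c]
  show "graph G" by unfold_locales
  show "3 \<le> k" by (rule k)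
  let ?f = "\<lambda>i. c (int i)"
  have per: "c (i mod int k) = c i" for i
    by (rule periodic_mod) (rule isometric_cycleD(3)[OF c])
  have inj: "?f i \<noteq> ?f j" if "i < j" "j < k" for i j
  proof -
    have "j - i \<le> k" using that by linarith
    then have "d (?f i) (?f j) = min (j - i) (k - (j - i))"
      using that by (intro isometric_cycle_d[OF c]) simp_all
    then show ?thesis using that by (intro notI) simp
  qed
  have idx: "\<exists>i<k. ?f i = x" if x: "x \<in> verts G" for x
  proof -
    obtain j where "x = c j" using x V by blast
    then show ?thesis
      using per[of j] k by (intro exI[of _ "nat (j mod int k)"]) (auto simp: nat_less_iff)
  qed
  have next_eq: "?f (Suc i mod k) = c (int i + 1)" for i
    using per[of "int i + 1"] by (simp add: zmod_int add.commute)
  show "bij_betw ?f {0..<k} (verts G)"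
    unfolding bij_betw_def inj_on_def
  proof (intro conjI ballI impI)
    fix i j assume ij: "i \<in> {0..<k}" "j \<in> {0..<k}" "?f i = ?f j"
    then show "i = j" using inj[of i j] inj[of j i] by (cases i j rule: linorder_cases) simp_all
  next
    show "?f ` {0..<k} = verts G" using V idx by (fastforce simp: image_iff)
  qed
  show "arcs_ends G = (\<Union>i\<in>{0..<k}. {(?f i, ?f (Suc i mod k)), (?f (Suc i mod k), ?f i)})"
  proof (intro equalityI subsetI)
    fix e assume e: "e \<in> arcs_ends G"
    obtain u v where uv: "e = (u, v)" by (cases e)
    have main: "\<exists>l<k. (u, v) \<in> {(?f l, ?f (Suc l mod k)), (?f (Suc l mod k), ?f l)}"
      if "i < j" "j < k" "?f i = u" "?f j = v" "(u, v) \<in> arcs_ends G" for i j u v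
    proof -
      have "min (j - i) (k - (j - i)) = 1"
        using isometric_cycle_d[OF c, of "int j" "int i" "j - i"] that d_edge[of u v] by auto
      then have "j = i + 1 \<or> i = 0 \<and> j = k - 1" using \<open>i < j\<close> \<open>j < k\<close> by linarith
      then consider "j = i + 1" | "i = 0" "j = k - 1" by blast
      then show ?thesis
      proof cases
        case 1
        then show ?thesis using that by (intro exI[of _ i]) auto
      next
        case 2
        then show ?thesis using that k by (intro exI[of _ j]) auto
      qed
    qed
    obtain i j where ij: "i < k" "j < k" "?f i = u" "?f j = v"
      using idx e uv E_V by metis
    have "i \<noteq> j" using ij e uv irrefl_E by auto
    then have "\<exists>l<k. e \<in> {(?f l, ?f (Suc l mod k)), (?f (Suc l mod k), ?f l)}"
      using main[of i j u v] main[of j i v u] ij e uv E_sym by (cases "i < j") auto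
    then show "e \<in> (\<Union>i\<in>{0..<k}. {(?f i, ?f (Suc i mod k)), (?f (Suc i mod k), ?f i)})"
      by auto
  next
    fix e assume "e \<in> (\<Union>i\<in>{0..<k}. {(?f i, ?f (Suc i mod k)), (?f (Suc i mod k), ?f i)})"
    then show "e \<in> arcs_ends G" using cE E_sym unfolding next_eq by auto
  qed
qed

text \<open>The enumeration \<open>f\<close> is extended periodically to the integers, where
  equality of vertices becomes congruence modulo \<open>n\<close>.\<close>

lemma odd_cycle_graph_unique_next_claw_free:
  assumes "odd n" "cycle_graph n G"
  shows "unique_next \<and> claw_free"
proof -
  obtain f where n: "3 \<le> n" and bij: "bij_betw f {0..<n} (verts G)"
    and ends: "arcs_ends G = (\<Union>i\<in>{0..<n}. {(f i, f (Suc i mod n)), (f (Suc i mod n), f i)})"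
    using assms(2) unfolding cycle_graph_def by blast
  define c where "c i = f (nat (i mod int n))" for i
  have idx: "nat (i mod int n) < n" for i using n by (simp add: nat_less_iff)
  have finj: "f i = f j \<longleftrightarrow> i = j" if "i < n" "j < n" for i j
    using bij that by (auto simp: bij_betw_def inj_on_def)
  have cf: "c (int i) = f (i mod n)" for i by (simp add: c_def zmod_int[symmetric])
  have cinj: "c i = c j \<longleftrightarrow> int n dvd i - j" for i j
    using finj[OF idx idx] n by (simp add: c_def mod_eq_dvd_iff[symmetric] nat_eq_iff)
  have V: "verts G = range c"
  proof (intro equalityI subsetI)
    fix x assume "x \<in> verts G"
    then obtain i where "i < n" "x = f i" using bij by (metis atLeastLessThan_iff bij_betw_def imageE)
    then have "x = c (int i)" using cf by simp
    then show "x \<in> range c" by blast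
  next
    fix x assume "x \<in> range c"
    then show "x \<in> verts G" using bij idx by (auto simp: bij_betw_def c_def)
  qed
  have next_eq: "f (Suc i mod n) = c (int i + 1)" for i
    using cf[of "Suc i"] by (simp add: add.commute)
  have edge: "(c i, c (i + 1)) \<in> arcs_ends G" for i
  proof -
    let ?i = "nat (i mod int n)"
    have "c i = f ?i" by (simp add: c_def)
    moreover have "c (i + 1) = f (Suc ?i mod n)"
      unfolding next_eq cinj using n by (simp add: mod_eq_dvd_iff[symmetric] mod_simps)
    ultimately show ?thesis using idx[of i] unfolding ends by force
  qed
  have nb: "x = c (i + 1) \<or> x = c (i - 1)" if "(c i, x) \<in> arcs_ends G" for i x
  proof -
    obtain j where j: "j < n" "c i = f j \<and> x = f (Suc j mod n) \<or> c i = f (Suc j mod n) \<and> x = f j"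
      using \<open>(c i, x) \<in> arcs_ends G\<close> unfolding ends by auto
    have fj: "f j = c (int j)" using cf[of j] j by simp
    from j(2) show ?thesis
    proof
      assume a: "c i = f j \<and> x = f (Suc j mod n)"
      then have "int n dvd i - int j" using fj cinj by metis
      then have "c (int j + 1) = c (i + 1)" unfolding cinj by (simp add: dvd_diff_commute)
      then show ?thesis using a next_eq by metis
    next
      assume a: "c i = f (Suc j mod n) \<and> x = f j"
      then have "int n dvd i - (int j + 1)" using next_eq cinj by metis
      then have "c (int j) = c (i - 1)" unfolding cinj by (simp add: dvd_diff_commute algebra_simps)
      then show ?thesis using a fj by metis
    qed
  qed
  show ?thesis
    using odd_cycle_unique_next[OF V _ edge nb cinj] cycle_claw_free[OF V nb] assms(1) by auto
qed

end

theorem theorem1: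
  fixes G :: "('a, 'b) pre_digraph"
  assumes "graph G" and "connected G"
  shows "geodetic G \<and> \<not> (\<exists>H. induced_subgraph H G \<and> complete_bipartite_digraph 1 3 H) \<longleftrightarrow>
    (\<exists>n. odd n \<and> cycle_graph n G) \<or>
    ((\<forall>B. block G B \<longrightarrow> (\<exists>n. complete_digraph n B)) \<and>
     (\<forall>x\<in>verts G. card {B. block G B \<and> x \<in> verts B} \<le> 2))"
proof -
  interpret graph G by fact
  interpret connected_graph G by unfold_locales fact
  \<comment> \<open>\<open>clique_blocks\<close> implies \<open>unique_next\<close>, and odd cycles
    satisfy both conditions on the left; the other direction is the case distinction.\<close>
  have "unique_next \<and> claw_free \<longleftrightarrow> (\<exists>n. odd n \<and> cycle_graph n G) \<or> clique_blocks \<and> claw_free"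
    using unique_next_claw_free_cases isometric_cycle_graph odd_cycle_graph_unique_next_claw_free
      clique_blocks_unique_next by blast
  then show ?thesis
    using geodetic_iff_unique_next claw_free_iff complete_blocks_iff clique_blocks_claw_free_iff by blast
qed

end
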